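(* Let $F(\boldsymbol\xi)=\mathbb E[f(\boldsymbol\xi,\boldsymbol\theta)]$, $\boldsymbol\xi\in\mathbb R^{d}$, with minimizer $\boldsymbol\xi^*$, be convex, differentiable, with $L$-Lipschitz gradient ($L>0$), and satisfy the Polyak--Łojasiewicz inequality $\frac12\|\nabla F(\boldsymbol x)\|^2\ge\mu(F(\boldsymbol x)-F(\boldsymbol\xi^* ))$ for all $\boldsymbol x\in\mathbb R^d$, with $\mu>0$; let $\kappa=L/\mu$. Assume there is $\sigma$ such that for all $\boldsymbol x,\boldsymbol y\in\mathbb R^d$ $$\mathbb E\big[\|\nabla_{\boldsymbol\xi} f(\boldsymbol x,\boldsymbol\theta)-\nabla_{\boldsymbol\xi} f(\boldsymbol y,\boldsymbol\theta)\|^2\big]\le\sigma^2\|\nabla F(\boldsymbol x)-\nabla F(\boldsymbol y)\|^2 .$$ Let $0<\epsilon<1$, $tol>0$, $V_*=\mathbb E\|\nabla_{\boldsymbol\xi} f(\boldsymbol\xi^*,\boldsymbol\theta)\|^2$, and let $(\boldsymbol\xi_k)$ be generated by SGD-A (see context) with step size $\eta=1/L$, relative error parameter $\epsilon$ and minimum batch size $M_{\min}\ge1$. With $k^*=\min\{k\ge0:\|\nabla F(\boldsymbol\xi_k)\|^2\le tol\}$, SGD-A generates the iterate $\boldsymbol\xi_{k^*}$, satisfying $\|\nabla F(\boldsymbol\xi_{k^*})\|^2\le tol$, with an expected gradient sampling cost $$\mathbb E[\mathcal C_{k^*-1}]\le\left(\frac{3(\sigma^2+1)}{\epsilon^2}+\frac{2V_*}{\epsilon^2\,tol}+M_{\min}\right)\left(\max\Big\{0,\frac{\kappa}{1-\epsilon^2}\log\big(tol^{-1}\,2L\,\mathbb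 E[F(\boldsymbol\xi_0)-F(\boldsymbol\xi^* )]\big)\Big\}+\frac{\kappa}{1-\epsilon^2}\right).$$
   Context: $\boldsymbol\theta\sim\pi$ is a random vector whose law $\pi$ does not depend on $\boldsymbol\xi$, and $\nabla F(\boldsymbol\xi)=\mathbb E[\nabla_{\boldsymbol\xi}f(\boldsymbol\xi,\boldsymbol\theta)]$. The initial point $\boldsymbol\xi_0$ may be random; all expectations involved are assumed finite. Convention: $\log 0=-\infty$. SGD-A (SGD with adaptive batch sizes): $\boldsymbol\xi_{k+1}=\boldsymbol\xi_k-\eta\boldsymbol\upsilon_k$ with $\boldsymbol\upsilon_k=M_k^{-1}\sum_{i=1}^{M_k}\nabla_{\boldsymbol\xi} f(\boldsymbol\xi_k,\boldsymbol\theta_{k,i})$, where at each iteration fresh i.i.d. samples $\boldsymbol\theta_{k,i}\sim\pi$ are drawn, independent of the past. With $V_k=\mathbb E\big[\|\nabla_{\boldsymbol\xi} f(\boldsymbol\xi_k,\boldsymbol\theta)-\nabla F(\boldsymbol\xi_k)\|^2\,\big|\,\boldsymbol\xi_k\big]$ (with $\boldsymbol\theta\sim\pi$ independent of $\boldsymbol\xi_k$), the batch size is the smallest integer $M_k\ge M_{\min}$ ($M_{\min}\geq 1$ an integer) with $V_k/M_k\le\epsilon^2\|\nabla F(\boldsymbol\xi_k)\|^2$; in particular the relative error condition $\mathbb E\|\boldsymbol\upsilon_k-\nabla F(\boldsymbol\xi_k)\|^2\le\epsilon^2\mathbb E\|\nabla F(\boldsymbol\xi_k)\|^2$ holds. The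 gradient sampling cost to generate $\boldsymbol\xi_{k^*}$ is $\mathcal C_{k^*-1}=\sum_{k=0}^{k^*-1}M_k$ (equal to $0$ if $k^*=0$). *)

theory Defs
  imports "HOL-Probability.Probability"
begin

text \<open>
  Throughout, \<open>\<pi>\<close> is the law of the random parameter, \<open>Df x t\<close> is the gradient in the first
  argument of the integrand at \<open>(x, t)\<close>, and \<open>DF x\<close> is the gradient of its mean at \<open>x\<close>.
\<close>

definition grad_variance ::
    "'t measure \<Rightarrow> ('a::euclidean_space \<Rightarrow> 't \<Rightarrow> 'a) \<Rightarrow> ('a \<Rightarrow> 'a) \<Rightarrow> 'a \<Rightarrow> real" where
  "grad_variance \<pi> Df DF x = (\<integral>t. (norm (Df x t - DF x))\<^sup>2 \<partial>\<pi>)"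

text \<open>
  The algorithm uses the variance conditional on the current iterate \<open>X\<close>, for a parameter \<open>T\<close> with
  law \<open>\<pi>\<close> independent of \<open>X\<close>. Conditional expectations are only determined almost everywhere; the
  following lemma shows that \<open>grad_variance \<pi> Df DF (X \<omega>)\<close> is a version of it.
\<close>

lemma grad_variance_cond_exp:
  fixes Df :: "'a::euclidean_space \<Rightarrow> 't \<Rightarrow> 'a" and X :: "'w \<Rightarrow> 'a"
  assumes P: "prob_space P"
    and X [measurable]: "X \<in> P \<rightarrow>\<^sub>M borel" and T [measurable]: "T \<in> P \<rightarrow>\<^sub>M \<pi>"
    and ind: "prob_space.indep_set P (sets (vimage_algebra (space P) X borel))
                (sets (vimage_algebra (space P) T \<pi>))"
    and law: "distr P \<pi> T = \<pi>"
    and Df [measurable]: "(\<lambda>(x, t). Df x t) \<in> borel_measurable (borel \<Otimes>\<^sub>M \<pi>)"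
    and DF [measurable]: "DF \<in> borel_measurable borel"
    and int: "integrable P (\<lambda>\<omega>. (norm (Df (X \<omega>) (T \<omega>) - DF (X \<omega>)))\<^sup>2)"
  shows "AE \<omega> in P. real_cond_exp P (vimage_algebra (space P) X borel)
           (\<lambda>\<omega>. (norm (Df (X \<omega>) (T \<omega>) - DF (X \<omega>)))\<^sup>2) \<omega> = grad_variance \<pi> Df DF (X \<omega>)"
proof -
  interpret P: prob_space P by (rule P)
  let ?F = "vimage_algebra (space P) X borel"
  let ?Q = "distr P borel X"
  define h where "h = (\<lambda>(x, t). (norm (Df x t - DF x))\<^sup>2)"
  have h [measurable]: "h \<in> borel_measurable (borel \<Otimes>\<^sub>M \<pi>)"
    unfolding h_def by measurable
  interpret pi: prob_space \<pi>
    using P.prob_space_distr[OF T] law by simp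
  interpret Q: prob_space ?Q by (rule P.prob_space_distr[OF X])
  interpret QP: pair_prob_space ?Q \<pi> ..
  have joint: "?Q \<Otimes>\<^sub>M \<pi> = distr P (borel \<Otimes>\<^sub>M \<pi>) (\<lambda>\<omega>. (X \<omega>, T \<omega>))"
  proof (rule pair_measure_eqI)
    fix A B assume "A \<in> sets ?Q" and B [measurable]: "B \<in> sets \<pi>"
    then have A [measurable]: "A \<in> sets borel" by simp
    have "X -` A \<inter> space P \<in> sets ?F" and "T -` B \<inter> space P \<in> sets (vimage_algebra (space P) T \<pi>)"
      by (auto intro: in_vimage_algebra)
    then have "P.prob ((X -` A \<inter> space P) \<inter> (T -` B \<inter> space P))
        = P.prob (X -` A \<inter> space P) * P.prob (T -` B \<inter> space P)"
      using ind by (auto dest: P.indep_setD)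
    moreover have "(X -` A \<inter> space P) \<inter> (T -` B \<inter> space P)
        = (\<lambda>\<omega>. (X \<omega>, T \<omega>)) -` (A \<times> B) \<inter> space P"
      by auto
    moreover have "emeasure \<pi> B = emeasure P (T -` B \<inter> space P)"
      using emeasure_distr[OF T B] law by simp
    ultimately show "emeasure ?Q A * emeasure \<pi> B
        = emeasure (distr P (borel \<Otimes>\<^sub>M \<pi>) (\<lambda>\<omega>. (X \<omega>, T \<omega>))) (A \<times> B)"
      by (simp add: emeasure_distr P.emeasure_eq_measure ennreal_mult)
  qed (auto simp: Q.sigma_finite_measure_axioms pi.sigma_finite_measure_axioms)
  have sets_joint: "sets (?Q \<Otimes>\<^sub>M \<pi>) = sets (borel \<Otimes>\<^sub>M \<pi>)"
    by (simp add: joint)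
  have gv: "grad_variance \<pi> Df DF = (\<lambda>x. \<integral>t. h (x, t) \<partial>\<pi>)"
    by (simp add: grad_variance_def h_def fun_eq_iff)
  have gv_meas [measurable]: "grad_variance \<pi> Df DF \<in> borel_measurable borel"
    unfolding gv by measurable
  have int_h: "integrable (?Q \<Otimes>\<^sub>M \<pi>) h"
    unfolding joint using int by (subst integrable_distr_eq) (auto simp: h_def)
  have int_gv: "integrable P (\<lambda>\<omega>. grad_variance \<pi> Df DF (X \<omega>))"
    using QP.integrable_fst'[OF int_h] by (simp add: gv[symmetric] integrable_distr_eq)
  have sub: "subalgebra P ?F"
    by (auto simp: subalgebra_def in_vimage_algebra sets_vimage_algebra2)
  interpret S: finite_measure_subalgebra P ?F
    by standard (rule sub)
  show ?thesis
  proof (rule S.real_cond_exp_charact)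
    fix A assume "A \<in> sets ?F"
    then obtain B where B [measurable]: "B \<in> sets borel" and A: "A = X -` B \<inter> space P"
      by (auto simp: sets_vimage_algebra2)
    have int_Bh: "integrable (?Q \<Otimes>\<^sub>M \<pi>) (\<lambda>(x, t). indicator B x * h (x, t))"
      by (rule Bochner_Integration.integrable_bound[OF int_h])
         (auto simp: measurable_cong_sets[OF sets_joint] split: split_indicator)
    have "(\<integral>\<omega>\<in>A. (norm (Df (X \<omega>) (T \<omega>) - DF (X \<omega>)))\<^sup>2 \<partial>P)
        = (\<integral>\<omega>. (\<lambda>(x, t). indicator B x * h (x, t)) (X \<omega>, T \<omega>) \<partial>P)"
      unfolding set_lebesgue_integral_def
      by (intro Bochner_Integration.integral_cong) (auto simp: A h_def split: split_indicator)
    also have "\<dots> = (\<integral>z. (\<lambda>(x, t). indicator B x * h (x, t)) z \<partial>(?Q \<Otimes>\<^sub>M \<pi>))"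
      unfolding joint by (rule integral_distr[symmetric]) measurable
    also have "\<dots> = (\<integral>x. (\<integral>t. indicator B x * h (x, t) \<partial>\<pi>) \<partial>?Q)"
      using QP.integral_fst'[OF int_Bh] by simp
    also have "\<dots> = (\<integral>x. indicator B x * grad_variance \<pi> Df DF x \<partial>?Q)"
      by (simp add: gv)
    also have "\<dots> = (\<integral>\<omega>. indicator B (X \<omega>) * grad_variance \<pi> Df DF (X \<omega>) \<partial>P)"
      by (rule integral_distr) measurable
    also have "\<dots> = (\<integral>\<omega>\<in>A. grad_variance \<pi> Df DF (X \<omega>) \<partial>P)"
      unfolding set_lebesgue_integral_def
      by (intro Bochner_Integration.integral_cong) (auto simp: A split: split_indicator)
    finally show "(\<integral>\<omega>\<in>A. (norm (Df (X \<omega>) (T \<omega>) - DF (X \<omega>)))\<^sup>2 \<partial>P)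
        = (\<integral>\<omega>\<in>A. grad_variance \<pi> Df DF (X \<omega>) \<partial>P)" .
  next
    show "(\<lambda>\<omega>. grad_variance \<pi> Df DF (X \<omega>)) \<in> borel_measurable ?F"
      by (rule measurable_compose[OF measurable_vimage_algebra1 gv_meas]) auto
  qed (rule int int_gv)+
qed

definition admissible_batch ::
    "'t measure \<Rightarrow> ('a::euclidean_space \<Rightarrow> 't \<Rightarrow> 'a) \<Rightarrow> ('a \<Rightarrow> 'a) \<Rightarrow> real \<Rightarrow> nat \<Rightarrow> 'a \<Rightarrow> nat \<Rightarrow> bool" where
  "admissible_batch \<pi> Df DF \<epsilon> Mmin x m \<longleftrightarrow>
     Mmin \<le> m \<and> grad_variance \<pi> Df DF x / real m \<le> \<epsilon>\<^sup>2 * (norm (DF x))\<^sup>2"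

definition is_batch_size ::
    "'t measure \<Rightarrow> ('a::euclidean_space \<Rightarrow> 't \<Rightarrow> 'a) \<Rightarrow> ('a \<Rightarrow> 'a) \<Rightarrow> real \<Rightarrow> nat \<Rightarrow> 'a \<Rightarrow> nat \<Rightarrow> bool" where
  "is_batch_size \<pi> Df DF \<epsilon> Mmin x m \<longleftrightarrow>
     admissible_batch \<pi> Df DF \<epsilon> Mmin x m \<and> (\<forall>n. admissible_batch \<pi> Df DF \<epsilon> Mmin x n \<longrightarrow> m \<le> n)"

text \<open>
  All samples are i.i.d. with law \<open>\<pi>\<close> and jointly independent of the initial point, so the samples
  of step \<open>k\<close> are independent of everything used in earlier steps.
\<close>

definition fresh_samples ::
    "'w measure \<Rightarrow> 't measure \<Rightarrow> ('w \<Rightarrow> 'a::euclidean_space) \<Rightarrow> (nat \<Rightarrow> nat \<Rightarrow> 'w \<Rightarrow> 't) \<Rightarrow> bool" where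
  "fresh_samples P \<pi> \<xi>0 \<theta> \<longleftrightarrow>
     (\<forall>k i. \<theta> k i \<in> P \<rightarrow>\<^sub>M \<pi> \<and> distr P \<pi> (\<theta> k i) = \<pi>) \<and>
     prob_space.indep_vars P (\<lambda>_. \<pi>) (\<lambda>(k, i). \<theta> k i) UNIV \<and>
     prob_space.indep_set P (sets (vimage_algebra (space P) \<xi>0 borel))
       (sets (vimage_algebra (space P) (\<lambda>\<omega> (k, i). \<theta> k i \<omega>)
         (\<Pi>\<^sub>M p\<in>(UNIV :: (nat \<times> nat) set). \<pi>)))"

text \<open>
  An admissible batch size fails to exist exactly when the gradient vanishes at the current iterate
  while the variance does not. The step is then undefined and nothing is required of the next
  iterate; this can only happen once every positive tolerance has been reached.
\<close>

definition sgd_adaptive ::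
    "'w measure \<Rightarrow> 't measure \<Rightarrow> ('a::euclidean_space \<Rightarrow> 't \<Rightarrow> 'a) \<Rightarrow> ('a \<Rightarrow> 'a) \<Rightarrow> real \<Rightarrow> real \<Rightarrow> nat \<Rightarrow>
     (nat \<Rightarrow> nat \<Rightarrow> 'w \<Rightarrow> 't) \<Rightarrow> (nat \<Rightarrow> 'w \<Rightarrow> 'a) \<Rightarrow> (nat \<Rightarrow> 'w \<Rightarrow> nat) \<Rightarrow> bool" where
  "sgd_adaptive P \<pi> Df DF \<eta> \<epsilon> Mmin \<theta> \<xi> M \<longleftrightarrow>
     (\<forall>k. \<xi> k \<in> borel_measurable P) \<and>
     (\<forall>k. M k \<in> P \<rightarrow>\<^sub>M count_space UNIV) \<and>
     fresh_samples P \<pi> (\<xi> 0) \<theta> \<and>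
     (AE \<omega> in P. \<forall>k. (\<exists>m. admissible_batch \<pi> Df DF \<epsilon> Mmin (\<xi> k \<omega>) m) \<longrightarrow>
        is_batch_size \<pi> Df DF \<epsilon> Mmin (\<xi> k \<omega>) (M k \<omega>) \<and>
        \<xi> (Suc k) \<omega> =
          \<xi> k \<omega> - \<eta> *\<^sub>R ((1 / real (M k \<omega>)) *\<^sub>R (\<Sum>i<M k \<omega>. Df (\<xi> k \<omega>) (\<theta> k i \<omega>))))"

text \<open>Only meaningful where the tolerance is reached, since \<open>LEAST\<close> is unspecified otherwise.\<close>

definition stopping_iteration ::
    "('a::euclidean_space \<Rightarrow> 'a) \<Rightarrow> real \<Rightarrow> (nat \<Rightarrow> 'w \<Rightarrow> 'a) \<Rightarrow> 'w \<Rightarrow> nat" where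
  "stopping_iteration DF tol \<xi> \<omega> = (LEAST k. (norm (DF (\<xi> k \<omega>)))\<^sup>2 \<le> tol)"

definition sampling_cost ::
    "('a::euclidean_space \<Rightarrow> 'a) \<Rightarrow> real \<Rightarrow> (nat \<Rightarrow> 'w \<Rightarrow> 'a) \<Rightarrow> (nat \<Rightarrow> 'w \<Rightarrow> nat) \<Rightarrow> 'w \<Rightarrow> real" where
  "sampling_cost DF tol \<xi> M \<omega> = (\<Sum>k<stopping_iteration DF tol \<xi> \<omega>. real (M k \<omega>))"

text \<open>The real \<^const>\<open>ln\<close> satisfies \<open>ln 0 = 0\<close>; here the logarithm of zero is \<open>-\<infinity>\<close>.\<close>

definition ln_ext :: "real \<Rightarrow> ereal" where
  "ln_ext x = (if x = 0 then -\<infinity> else ereal (ln x))"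

end

theory Submission
  imports Defs
begin

text \<open>
  Write \<open>\<Delta>\<^sub>k\<close> for the optimality gap \<open>F (\<xi> k) - F xs\<close>, \<open>g\<^sub>k\<close> for \<open>DF (\<xi> k)\<close> and \<open>A\<^sub>k\<close> for the event
  that \<open>\<parallel>g\<^sub>j\<parallel>\<^sup>2 > tol\<close> for all \<open>j \<le> k\<close>, that is, \<open>k < k\<^sup>*\<close>. The cost is the sum over \<open>k\<close> of the batch
  sizes restricted to \<open>A\<^sub>k\<close>, so it suffices to bound the batch sizes on \<open>A\<^sub>k\<close> by a constant and to
  bound the expected number \<open>\<Sum>k. P (A\<^sub>k)\<close> of iterations.

  On \<open>A\<^sub>k\<close> a batch larger than \<open>Mmin\<close> with one sample removed violates the variance test, so its
  size exceeds \<open>V\<^sub>k / (\<epsilon>\<^sup>2 \<parallel>g\<^sub>k\<parallel>\<^sup>2)\<close> by at most one. Comparison with the minimizer, where the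
  gradient of \<open>F\<close> vanishes, gives \<open>V\<^sub>k \<le> 2 \<sigma>\<^sup>2 \<parallel>g\<^sub>k\<parallel>\<^sup>2 + 2 Vs\<close>, and \<open>\<parallel>g\<^sub>k\<parallel>\<^sup>2 > tol\<close> turns this into
  a constant (lemma \<open>batch_le\<close>).

  For the number of iterations, \<open>L\<close>-smoothness and unbiasedness give that a step from \<open>\<xi> k\<close> lowers
  the expected gap by at least \<open>(1 - \<epsilon>\<^sup>2) \<parallel>g\<^sub>k\<parallel>\<^sup>2 / (2 L)\<close>, and the Polyak--Lojasiewicz inequality makes
  this a contraction by \<open>1 - a\<close> with \<open>a = (1 - \<epsilon>\<^sup>2) / \<kappa>\<close> (lemma \<open>expected_gap_after_step\<close>). The numbers
  \<open>c\<^sub>k = (2 L / tol) E (\<Delta>\<^sub>k 1\<^bsub>A\<^sub>k\<^esub>)\<close> then satisfy \<open>c\<^sub>k\<^sub>+\<^sub>1 \<le> (1 - a) c\<^sub>k\<close>, because \<open>A\<^sub>k\<^sub>+\<^sub>1\<close> lies in \<open>A\<^sub>k\<close>.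
  Since \<open>\<parallel>g\<^sub>k\<parallel>\<^sup>2 \<le> 2 L \<Delta>\<^sub>k\<close>, Markov's inequality gives \<open>P (A\<^sub>k) \<le> min 1 c\<^sub>k\<close>. A concave logarithmic
  potential telescopes the sum of these minima to at most \<open>(1 + max 0 (ln C)) / a\<close>, where
  \<open>C = (2 L / tol) E \<Delta>\<^sub>0 \<ge> c\<^sub>0\<close> (lemma \<open>sum_min_one_contracting_le\<close>). Finiteness of the sum also shows
  that the run stops almost surely.

  The contraction needs the samples of iteration \<open>k\<close> to be independent of the iterate they are used
  at. As nothing constrains an iterate that follows one without an admissible batch, the argument is
  carried out for the run frozen at its first converged iterate. That process is a function of the
  starting point and the earlier samples (lemma \<open>current_iterate_indep_block\<close>), and it almost surely
  agrees with the given run for as long as the latter has not converged (lemma \<open>AE_active\<close>).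
\<close>

section \<open>Functions with Lipschitz gradient\<close>

text \<open>
  Along the segment from \<open>x\<close> to \<open>y\<close> the difference of the two sides is antitone: the Lipschitz
  condition bounds its derivative.
\<close>

lemma lipschitz_gradient_quadratic_upper_bound:
  fixes F :: "'a::real_inner \<Rightarrow> real"
  assumes grad: "\<And>x. GDERIV F x :> DF x" and lip: "L-lipschitz_on UNIV DF"
  shows "F y \<le> F x + DF x \<bullet> (y - x) + L / 2 * (norm (y - x))\<^sup>2"
proof -
  define d where "d = y - x"
  define h where "h = (\<lambda>s. F (x + s *\<^sub>R d) - s * (DF x \<bullet> d) - L / 2 * s\<^sup>2 * (norm d)\<^sup>2)"
  have "(h has_real_derivative (DF (x + s *\<^sub>R d) \<bullet> d - DF x \<bullet> d - L * s * (norm d)\<^sup>2)) (at s)" for s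
  proof -
    have "(F has_derivative (\<lambda>v. v \<bullet> DF (x + s *\<^sub>R d))) (at (x + s *\<^sub>R d))"
      using grad by (simp add: gderiv_def)
    then have "((\<lambda>s. F (x + s *\<^sub>R d)) has_derivative (\<lambda>r. (r *\<^sub>R d) \<bullet> DF (x + s *\<^sub>R d))) (at s)"
      by (rule has_derivative_compose[rotated]) (auto intro!: derivative_eq_intros)
    then have "((\<lambda>s. F (x + s *\<^sub>R d)) has_real_derivative (DF (x + s *\<^sub>R d) \<bullet> d)) (at s)"
      unfolding has_field_derivative_def
      by (rule has_derivative_eq_rhs) (auto simp: fun_eq_iff inner_commute)
    then show ?thesis
      unfolding h_def by (auto intro!: derivative_eq_intros)
  qed
  moreover have "DF (x + s *\<^sub>R d) \<bullet> d - DF x \<bullet> d - L * s * (norm d)\<^sup>2 \<le> 0" if "0 \<le> s" for s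
  proof -
    have "(DF (x + s *\<^sub>R d) - DF x) \<bullet> d \<le> norm (DF (x + s *\<^sub>R d) - DF x) * norm d"
      by (rule norm_cauchy_schwarz)
    also have "\<dots> \<le> (L * (s * norm d)) * norm d"
      using lipschitz_onD[OF lip, of "x + s *\<^sub>R d" x] that
      by (intro mult_right_mono) (auto simp: dist_norm)
    finally show ?thesis
      by (simp add: inner_diff_left power2_eq_square algebra_simps)
  qed
  ultimately have "\<exists>D. (h has_real_derivative D) (at s) \<and> D \<le> 0" if "0 \<le> s" for s
    using that by blast
  then have "h 1 \<le> h 0"
    by (intro DERIV_nonpos_imp_nonincreasing[of 0 1 h]) simp_all
  then show ?thesis
    by (simp add: h_def d_def)
qed

text \<open>
  A gradient step of length \<open>1 / L\<close> lowers \<open>F\<close> by at least \<open>\<parallel>DF x\<parallel>\<^sup>2 / (2 L)\<close>, but not below its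
  minimum.
\<close>

lemma gradient_norm_le_optimality_gap:
  fixes F :: "'a::real_inner \<Rightarrow> real"
  assumes grad: "\<And>x. GDERIV F x :> DF x" and L: "L > 0" "L-lipschitz_on UNIV DF"
    and minimizer: "\<And>x. F xs \<le> F x"
  shows "(norm (DF x))\<^sup>2 \<le> 2 * L * (F x - F xs)"
proof -
  have "F xs \<le> F (x - (1 / L) *\<^sub>R DF x)"
    by (rule minimizer)
  also have "\<dots> \<le> F x - (1 / L) * (norm (DF x))\<^sup>2 + L / 2 * ((1 / L) * norm (DF x))\<^sup>2"
    using lipschitz_gradient_quadratic_upper_bound[OF grad L(2), of "x - (1 / L) *\<^sub>R DF x" x] L(1)
    by (simp add: power2_norm_eq_inner)
  also have "\<dots> = F x - (norm (DF x))\<^sup>2 / (2 * L)"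
    using L(1) by (simp add: power2_eq_square field_simps)
  finally show ?thesis
    using L(1) by (simp add: field_simps)
qed

section \<open>Summing a truncated geometric sequence\<close>

text \<open>
  The concave, continuously differentiable function whose slope at \<open>c\<close> is \<open>min 1 (1 / c)\<close> for
  positive \<open>c\<close>: multiplied by \<open>a c\<close>, this slope is exactly the quantity \<open>a min 1 c\<close> that is to be
  summed along a contraction by \<open>1 - a\<close>.
\<close>

definition log_potential :: "real \<Rightarrow> real" where
  "log_potential c = (if c \<le> 1 then c else 1 + ln c)"

lemma log_potential_le: "0 \<le> c \<Longrightarrow> log_potential c \<le> 1 + max 0 (ln c)"
  by (auto simp: log_potential_def max_def)

lemma log_potential_mono: "c \<le> d \<Longrightarrow> log_potential c \<le> log_potential d"
  by (auto simp: log_potential_def intro: order_trans[of c 1])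

text \<open>
  Concavity puts the potential below its tangent at \<open>c\<close>, whose value drops by at least the slope
  times \<open>a c\<close> between \<open>c\<close> and \<open>c'\<close>.
\<close>

lemma log_potential_decrease:
  assumes "0 \<le> c" "c' \<le> (1 - a) * c"
  shows "a * min 1 c \<le> log_potential c - log_potential c'"
proof (cases "c \<le> 1")
  case True
  have "log_potential y \<le> y" for y
    using ln_le_minus_one[of y] by (auto simp: log_potential_def)
  from this[of c'] show ?thesis
    using assms True by (simp add: log_potential_def algebra_simps)
next
  case False
  have tangent: "log_potential y \<le> 1 + ln c + (y - c) / c" for y
  proof (cases "y \<le> 1")
    case True
    have "ln (1 / c) \<le> 1 / c - 1"
      using False by (intro ln_le_minus_one) simp
    then have "0 \<le> ln c - 1 + 1 / c"
      using False by (simp add: ln_div)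
    moreover have "(1 - y) * 1 \<ge> (1 - y) * (1 / c)"
      using True False by (intro mult_left_mono) auto
    ultimately show ?thesis
      using True False by (simp add: log_potential_def field_simps)
  next
    case y: False
    have "ln (y / c) \<le> y / c - 1"
      using y False by (intro ln_le_minus_one) simp
    then show ?thesis
      using y False by (simp add: log_potential_def ln_div diff_divide_distrib)
  qed
  have "(c' - c) / c \<le> - a"
    using assms False by (simp add: field_simps)
  then show ?thesis
    using tangent[of c'] False by (simp add: log_potential_def)
qed

text \<open>
  The decrements of the potential telescope. This avoids splitting the sum at the index where the
  sequence crosses one, and rounding that index.
\<close>

lemma sum_min_one_contracting_le:
  fixes c :: "nat \<Rightarrow> real"
  assumes nonneg: "\<And>k. 0 \<le> c k" and contr: "\<And>k. c (Suc k) \<le> (1 - a) * c k" and a: "0 < a"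
    and C: "c 0 \<le> C"
  shows "(\<Sum>k<n. min 1 (c k)) \<le> (1 + max 0 (ln C)) / a"
proof -
  have "a * (\<Sum>k<n. min 1 (c k)) \<le> (\<Sum>k<n. log_potential (c k) - log_potential (c (Suc k)))"
    unfolding sum_distrib_left by (intro sum_mono log_potential_decrease nonneg contr)
  also have "\<dots> = log_potential (c 0) - log_potential (c n)"
    by (rule sum_lessThan_telescope')
  also have "\<dots> \<le> log_potential C"
    using log_potential_mono[OF C] log_potential_mono[OF nonneg[of n]]
    by (simp add: log_potential_def[of 0])
  also have "\<dots> \<le> 1 + max 0 (ln C)"
    using nonneg[of 0] C by (intro log_potential_le) simp
  finally show ?thesis
    using a by (simp add: field_simps)
qed

section \<open>Second moments\<close>

lemma integrable_inner_of_square_integrable: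
  fixes X Y :: "'w \<Rightarrow> 'b::euclidean_space"
  assumes [measurable]: "X \<in> borel_measurable M" "Y \<in> borel_measurable M"
    and "integrable M (\<lambda>\<omega>. (norm (X \<omega>))\<^sup>2)" "integrable M (\<lambda>\<omega>. (norm (Y \<omega>))\<^sup>2)"
  shows "integrable M (\<lambda>\<omega>. X \<omega> \<bullet> Y \<omega>)"
proof (rule Bochner_Integration.integrable_bound)
  show "integrable M (\<lambda>\<omega>. (norm (X \<omega>))\<^sup>2 + (norm (Y \<omega>))\<^sup>2)"
    using assms by simp
  have "\<bar>x \<bullet> y\<bar> \<le> (norm x)\<^sup>2 + (norm y)\<^sup>2" for x y :: 'b
  proof -
    have "\<bar>x \<bullet> y\<bar> \<le> norm x * norm y"
      by (rule Cauchy_Schwarz_ineq2)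
    also have "\<dots> \<le> 2 * norm x * norm y"
      by simp
    also have "\<dots> \<le> (norm x)\<^sup>2 + (norm y)\<^sup>2"
      by (rule sum_squares_bound)
    finally show ?thesis .
  qed
  then show "AE \<omega> in M. norm (X \<omega> \<bullet> Y \<omega>) \<le> norm ((norm (X \<omega>))\<^sup>2 + (norm (Y \<omega>))\<^sup>2)"
    by simp
qed measurable

lemma integrable_norm_square_add:
  fixes X Y :: "'w \<Rightarrow> 'b::euclidean_space"
  assumes [measurable]: "X \<in> borel_measurable M" "Y \<in> borel_measurable M"
    and "integrable M (\<lambda>\<omega>. (norm (X \<omega>))\<^sup>2)" "integrable M (\<lambda>\<omega>. (norm (Y \<omega>))\<^sup>2)"
  shows "integrable M (\<lambda>\<omega>. (norm (X \<omega> + Y \<omega>))\<^sup>2)"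
proof -
  have "(norm (X \<omega> + Y \<omega>))\<^sup>2 = (norm (X \<omega>))\<^sup>2 + (norm (Y \<omega>))\<^sup>2 + 2 * (X \<omega> \<bullet> Y \<omega>)" for \<omega>
    by (simp add: power2_norm_eq_inner inner_simps inner_commute)
  then show ?thesis
    using assms integrable_inner_of_square_integrable[of X M Y] by simp
qed

lemma (in prob_space) expectation_norm_square_centered:
  fixes Y :: "'a \<Rightarrow> 'b::euclidean_space"
  assumes Y: "integrable M Y" "integrable M (\<lambda>\<omega>. (norm (Y \<omega>))\<^sup>2)"
  shows "expectation (\<lambda>\<omega>. (norm (Y \<omega> - expectation Y))\<^sup>2)
    = expectation (\<lambda>\<omega>. (norm (Y \<omega>))\<^sup>2) - (norm (expectation Y))\<^sup>2"
proof -
  have "(norm (Y \<omega> - expectation Y))\<^sup>2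
      = (norm (Y \<omega>))\<^sup>2 - 2 * (Y \<omega> \<bullet> expectation Y) + (norm (expectation Y))\<^sup>2" for \<omega>
    by (simp add: power2_norm_eq_inner inner_simps inner_commute)
  then have "expectation (\<lambda>\<omega>. (norm (Y \<omega> - expectation Y))\<^sup>2)
      = expectation (\<lambda>\<omega>. (norm (Y \<omega>))\<^sup>2) - 2 * expectation (\<lambda>\<omega>. Y \<omega> \<bullet> expectation Y)
        + (norm (expectation Y))\<^sup>2"
    using Y by (simp add: prob_space)
  also have "expectation (\<lambda>\<omega>. Y \<omega> \<bullet> expectation Y) = (norm (expectation Y))\<^sup>2"
    using Y by (simp add: power2_norm_eq_inner)
  finally show ?thesis
    by simp
qed

text \<open>
  Apply the product rule for expectations of independent real variables to each coordinate.
\<close>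

lemma (in prob_space) expectation_inner_indep:
  fixes X Y :: "'a \<Rightarrow> 'b::euclidean_space"
  assumes indep: "indep_var borel X borel Y"
    and X: "integrable M X" and Y: "integrable M Y"
  shows "expectation (\<lambda>\<omega>. X \<omega> \<bullet> Y \<omega>) = expectation X \<bullet> expectation Y"
proof -
  have ind: "indep_var borel (\<lambda>\<omega>. X \<omega> \<bullet> b) borel (\<lambda>\<omega>. Y \<omega> \<bullet> b)" for b
    using indep_var_compose[OF indep, of "\<lambda>x. x \<bullet> b" borel "\<lambda>x. x \<bullet> b" borel]
    by (simp add: comp_def)
  have int: "integrable M (\<lambda>\<omega>. (X \<omega> \<bullet> b) * (Y \<omega> \<bullet> b))" for b
    using X Y by (intro indep_var_integrable[OF ind]) auto
  have "expectation (\<lambda>\<omega>. X \<omega> \<bullet> Y \<omega>)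
      = (\<Sum>b\<in>Basis. expectation (\<lambda>\<omega>. (X \<omega> \<bullet> b) * (Y \<omega> \<bullet> b)))"
    using int by (subst euclidean_inner) simp
  also have "\<dots> = (\<Sum>b\<in>Basis. (expectation X \<bullet> b) * (expectation Y \<bullet> b))"
    using X Y by (simp add: indep_var_lebesgue_integral[OF ind])
  finally show ?thesis
    by (simp add: euclidean_inner[symmetric])
qed

text \<open>
  Independent centered vectors are orthogonal in mean, so only the diagonal of the expanded square
  survives.
\<close>

lemma (in prob_space) expectation_norm_square_sum_indep_centered:
  fixes Z :: "'i \<Rightarrow> 'a \<Rightarrow> 'b::euclidean_space"
  assumes I: "finite I" and indep: "indep_vars (\<lambda>_. borel) Z I"
    and int: "\<And>i. i \<in> I \<Longrightarrow> integrable M (Z i)"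
    and sq: "\<And>i. i \<in> I \<Longrightarrow> integrable M (\<lambda>\<omega>. (norm (Z i \<omega>))\<^sup>2)"
    and centered: "\<And>i. i \<in> I \<Longrightarrow> expectation (Z i) = 0"
  shows "integrable M (\<lambda>\<omega>. (norm (\<Sum>i\<in>I. Z i \<omega>))\<^sup>2)"
    and "expectation (\<lambda>\<omega>. (norm (\<Sum>i\<in>I. Z i \<omega>))\<^sup>2)
      = (\<Sum>i\<in>I. expectation (\<lambda>\<omega>. (norm (Z i \<omega>))\<^sup>2))"
proof -
  have inner_int: "integrable M (\<lambda>\<omega>. Z i \<omega> \<bullet> Z j \<omega>)" if "i \<in> I" "j \<in> I" for i j
    using int[OF that(1)] int[OF that(2)] sq that
    by (intro integrable_inner_of_square_integrable) auto
  have expand: "(norm (\<Sum>i\<in>I. Z i \<omega>))\<^sup>2 = (\<Sum>i\<in>I. \<Sum>j\<in>I. Z i \<omega> \<bullet> Z j \<omega>)" for \<omega>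
    by (simp add: power2_norm_eq_inner inner_sum_left inner_sum_right)
       (rule sum.swap)
  show "integrable M (\<lambda>\<omega>. (norm (\<Sum>i\<in>I. Z i \<omega>))\<^sup>2)"
    unfolding expand by (intro Bochner_Integration.integrable_sum inner_int)
  have "expectation (\<lambda>\<omega>. (norm (\<Sum>i\<in>I. Z i \<omega>))\<^sup>2)
      = (\<Sum>i\<in>I. \<Sum>j\<in>I. expectation (\<lambda>\<omega>. Z i \<omega> \<bullet> Z j \<omega>))"
    unfolding expand using inner_int by simp
  also have "\<dots> = (\<Sum>i\<in>I. \<Sum>j\<in>I. if j = i then expectation (\<lambda>\<omega>. (norm (Z i \<omega>))\<^sup>2) else 0)"
  proof (intro sum.cong refl)
    fix i j assume ij: "i \<in> I" "j \<in> I"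
    show "expectation (\<lambda>\<omega>. Z i \<omega> \<bullet> Z j \<omega>)
        = (if j = i then expectation (\<lambda>\<omega>. (norm (Z i \<omega>))\<^sup>2) else 0)"
    proof (cases "j = i")
      case False
      then have "indep_var borel (Z i) borel (Z j)"
        using indep_var_compose[OF indep_var_restrict[OF indep, of "{i}" "{j}"],
            of "\<lambda>g. g i" borel "\<lambda>g. g j" borel] ij by (simp add: comp_def)
      then show ?thesis
        using ij int centered False by (simp add: expectation_inner_indep)
    qed (simp add: power2_norm_eq_inner)
  qed
  also have "\<dots> = (\<Sum>i\<in>I. expectation (\<lambda>\<omega>. (norm (Z i \<omega>))\<^sup>2))"
    using I by simp
  finally show "expectation (\<lambda>\<omega>. (norm (\<Sum>i\<in>I. Z i \<omega>))\<^sup>2)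
      = (\<Sum>i\<in>I. expectation (\<lambda>\<omega>. (norm (Z i \<omega>))\<^sup>2))" .
qed

section \<open>Independence of the past and the current sample block\<close>

text \<open>
  Independence of variables with values in different types is expressed by saying that their joint
  law is a product measure.
\<close>

lemma (in prob_space) joint_law_eq_pair_measure:
  assumes X [measurable]: "X \<in> M \<rightarrow>\<^sub>M S" and Y [measurable]: "Y \<in> M \<rightarrow>\<^sub>M T"
    and indep: "indep_set (sets (vimage_algebra (space M) X S)) (sets (vimage_algebra (space M) Y T))"
  shows "distr M (S \<Otimes>\<^sub>M T) (\<lambda>\<omega>. (X \<omega>, Y \<omega>)) = distr M S X \<Otimes>\<^sub>M distr M T Y"
proof (rule pair_measure_eqI[symmetric])
  show "sigma_finite_measure (distr M S X)" "sigma_finite_measure (distr M T Y)"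
    by (auto intro!: prob_space_imp_sigma_finite prob_space_distr)
  fix A B assume "A \<in> sets (distr M S X)" "B \<in> sets (distr M T Y)"
  then have [measurable]: "A \<in> sets S" "B \<in> sets T"
    by auto
  have "X -` A \<inter> space M \<in> sets (vimage_algebra (space M) X S)"
      "Y -` B \<inter> space M \<in> sets (vimage_algebra (space M) Y T)"
    by (auto intro: in_vimage_algebra)
  then have "prob ((X -` A \<inter> space M) \<inter> (Y -` B \<inter> space M))
      = prob (X -` A \<inter> space M) * prob (Y -` B \<inter> space M)"
    by (rule indep_setD[OF indep])
  moreover have "(X -` A \<inter> space M) \<inter> (Y -` B \<inter> space M)
      = (\<lambda>\<omega>. (X \<omega>, Y \<omega>)) -` (A \<times> B) \<inter> space M"
    by auto
  ultimately show "emeasure (distr M S X) A * emeasure (distr M T Y) B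
      = emeasure (distr M (S \<Otimes>\<^sub>M T) (\<lambda>\<omega>. (X \<omega>, Y \<omega>))) (A \<times> B)"
    by (simp add: emeasure_distr emeasure_eq_measure ennreal_mult)
qed (auto cong: sets_pair_measure_cong)

lemma (in prob_space) joint_law_compose:
  assumes X [measurable]: "X \<in> M \<rightarrow>\<^sub>M S" and Y [measurable]: "Y \<in> M \<rightarrow>\<^sub>M T"
    and f [measurable]: "f \<in> S \<rightarrow>\<^sub>M S'" and g [measurable]: "g \<in> T \<rightarrow>\<^sub>M T'"
    and XY: "distr M (S \<Otimes>\<^sub>M T) (\<lambda>\<omega>. (X \<omega>, Y \<omega>)) = distr M S X \<Otimes>\<^sub>M distr M T Y"
  shows "distr M (S' \<Otimes>\<^sub>M T') (\<lambda>\<omega>. (f (X \<omega>), g (Y \<omega>)))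
    = distr M S' (\<lambda>\<omega>. f (X \<omega>)) \<Otimes>\<^sub>M distr M T' (\<lambda>\<omega>. g (Y \<omega>))"
proof (rule pair_measure_eqI[symmetric])
  show "sigma_finite_measure (distr M S' (\<lambda>\<omega>. f (X \<omega>)))"
      "sigma_finite_measure (distr M T' (\<lambda>\<omega>. g (Y \<omega>)))"
    by (auto intro!: prob_space_imp_sigma_finite prob_space_distr)
  interpret Y: prob_space "distr M T Y" by (rule prob_space_distr) simp
  fix A B assume "A \<in> sets (distr M S' (\<lambda>\<omega>. f (X \<omega>)))" "B \<in> sets (distr M T' (\<lambda>\<omega>. g (Y \<omega>)))"
  then have [measurable]: "A \<in> sets S'" "B \<in> sets T'"
    by auto
  have "emeasure (distr M (S' \<Otimes>\<^sub>M T') (\<lambda>\<omega>. (f (X \<omega>), g (Y \<omega>)))) (A \<times> B)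
      = emeasure (distr M (S \<Otimes>\<^sub>M T) (\<lambda>\<omega>. (X \<omega>, Y \<omega>))) ((f -` A \<inter> space S) \<times> (g -` B \<inter> space T))"
    using measurable_space[OF X] measurable_space[OF Y]
    by (subst (1 2) emeasure_distr) (auto intro!: arg_cong[where f="emeasure M"])
  also have "\<dots> = emeasure (distr M S X) (f -` A \<inter> space S) * emeasure (distr M T Y) (g -` B \<inter> space T)"
    unfolding XY by (rule Y.emeasure_pair_measure_Times) auto
  also have "\<dots> = emeasure (distr M S' (\<lambda>\<omega>. f (X \<omega>))) A * emeasure (distr M T' (\<lambda>\<omega>. g (Y \<omega>))) B"
    using measurable_space[OF X] measurable_space[OF Y]
    by (subst (1 2 3 4) emeasure_distr)
       (auto intro!: arg_cong2[where f="(*)"] arg_cong[where f="emeasure M"])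
  finally show "emeasure (distr M S' (\<lambda>\<omega>. f (X \<omega>))) A * emeasure (distr M T' (\<lambda>\<omega>. g (Y \<omega>))) B
      = emeasure (distr M (S' \<Otimes>\<^sub>M T') (\<lambda>\<omega>. (f (X \<omega>), g (Y \<omega>)))) (A \<times> B)" ..
qed (auto cong: sets_pair_measure_cong)

text \<open>
  If \<open>U\<close> is independent of the pair \<open>(V, W)\<close> whose components are independent, then \<open>W\<close> is
  independent of the pair \<open>(U, V)\<close>: by Fubini in \<open>U\<close>, the probability of \<open>(U, V) \<in> A\<close> and \<open>W \<in> C\<close>
  factors section by section. Below, \<open>U\<close> is the starting point, \<open>V\<close> collects the past samples and
  \<open>W\<close> the current ones.
\<close>

lemma (in prob_space) joint_law_assoc:
  assumes [measurable]: "U \<in> M \<rightarrow>\<^sub>M S" "V \<in> M \<rightarrow>\<^sub>M T1" "W \<in> M \<rightarrow>\<^sub>M T2"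
    and U: "distr M (S \<Otimes>\<^sub>M (T1 \<Otimes>\<^sub>M T2)) (\<lambda>\<omega>. (U \<omega>, V \<omega>, W \<omega>))
      = distr M S U \<Otimes>\<^sub>M distr M (T1 \<Otimes>\<^sub>M T2) (\<lambda>\<omega>. (V \<omega>, W \<omega>))"
    and VW: "distr M (T1 \<Otimes>\<^sub>M T2) (\<lambda>\<omega>. (V \<omega>, W \<omega>)) = distr M T1 V \<Otimes>\<^sub>M distr M T2 W"
  shows "distr M ((S \<Otimes>\<^sub>M T1) \<Otimes>\<^sub>M T2) (\<lambda>\<omega>. ((U \<omega>, V \<omega>), W \<omega>))
    = distr M (S \<Otimes>\<^sub>M T1) (\<lambda>\<omega>. (U \<omega>, V \<omega>)) \<Otimes>\<^sub>M distr M T2 W"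
proof -
  interpret U: prob_space "distr M S U" by (rule prob_space_distr) simp
  interpret V: prob_space "distr M T1 V" by (rule prob_space_distr) simp
  interpret W: prob_space "distr M T2 W" by (rule prob_space_distr) simp
  interpret VW: pair_prob_space "distr M T1 V" "distr M T2 W" ..
  have rectangle: "emeasure (distr M ((S \<Otimes>\<^sub>M T1) \<Otimes>\<^sub>M T2) (\<lambda>\<omega>. ((U \<omega>, V \<omega>), W \<omega>))) (A \<times> C)
      = emeasure (distr M S U \<Otimes>\<^sub>M distr M T1 V) A * emeasure (distr M T2 W) C"
    if [measurable]: "A \<in> sets (S \<Otimes>\<^sub>M T1)" "C \<in> sets T2" for A C
  proof -
    define D where "D = (\<lambda>(u, v, w). ((u, v), w)) -` (A \<times> C) \<inter> space (S \<Otimes>\<^sub>M (T1 \<Otimes>\<^sub>M T2))"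
    have "(\<lambda>(u, v, w). ((u, v), w)) \<in> S \<Otimes>\<^sub>M (T1 \<Otimes>\<^sub>M T2) \<rightarrow>\<^sub>M (S \<Otimes>\<^sub>M T1) \<Otimes>\<^sub>M T2"
      by measurable
    then have [measurable]: "D \<in> sets (S \<Otimes>\<^sub>M (T1 \<Otimes>\<^sub>M T2))"
      unfolding D_def by (rule measurable_sets) simp
    have slice: "Pair u -` D = (Pair u -` A) \<times> C" if "u \<in> space S" for u
      using that sets.sets_into_space[of A "S \<Otimes>\<^sub>M T1"] sets.sets_into_space[of C T2]
      by (auto simp: D_def space_pair_measure)
    have "emeasure (distr M ((S \<Otimes>\<^sub>M T1) \<Otimes>\<^sub>M T2) (\<lambda>\<omega>. ((U \<omega>, V \<omega>), W \<omega>))) (A \<times> C)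
        = emeasure (distr M (S \<Otimes>\<^sub>M (T1 \<Otimes>\<^sub>M T2)) (\<lambda>\<omega>. (U \<omega>, V \<omega>, W \<omega>))) D"
      using measurable_space[of U M S] measurable_space[of V M T1] measurable_space[of W M T2]
      by (subst (1 2) emeasure_distr)
         (auto simp: D_def space_pair_measure intro!: arg_cong[where f="emeasure M"])
    also have "\<dots> = (\<integral>\<^sup>+u. emeasure (distr M T1 V \<Otimes>\<^sub>M distr M T2 W) (Pair u -` D) \<partial>distr M S U)"
      unfolding U VW by (rule VW.emeasure_pair_measure_alt) (simp cong: sets_pair_measure_cong)
    also have "\<dots> = (\<integral>\<^sup>+u. emeasure (distr M T1 V) (Pair u -` A) * emeasure (distr M T2 W) C \<partial>distr M S U)"
      by (intro nn_integral_cong)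
         (simp add: slice W.emeasure_pair_measure_Times sets_Pair1[of A S T1])
    also have "\<dots> = (\<integral>\<^sup>+u. emeasure (distr M T1 V) (Pair u -` A) \<partial>distr M S U) * emeasure (distr M T2 W) C"
      by (intro nn_integral_multc V.measurable_emeasure_Pair) (simp cong: sets_pair_measure_cong)
    also have "(\<integral>\<^sup>+u. emeasure (distr M T1 V) (Pair u -` A) \<partial>distr M S U)
        = emeasure (distr M S U \<Otimes>\<^sub>M distr M T1 V) A"
      by (rule V.emeasure_pair_measure_alt[symmetric]) (simp cong: sets_pair_measure_cong)
    finally show ?thesis .
  qed
  \<comment> \<open>Taking \<open>C\<close> to be the whole space identifies the law of the first pair.\<close>
  have UV: "distr M (S \<Otimes>\<^sub>M T1) (\<lambda>\<omega>. (U \<omega>, V \<omega>)) = distr M S U \<Otimes>\<^sub>M distr M T1 V"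
  proof (rule measure_eqI)
    fix A assume "A \<in> sets (distr M (S \<Otimes>\<^sub>M T1) (\<lambda>\<omega>. (U \<omega>, V \<omega>)))"
    then have A [measurable]: "A \<in> sets (S \<Otimes>\<^sub>M T1)"
      by simp
    have "emeasure (distr M (S \<Otimes>\<^sub>M T1) (\<lambda>\<omega>. (U \<omega>, V \<omega>))) A
        = emeasure (distr M ((S \<Otimes>\<^sub>M T1) \<Otimes>\<^sub>M T2) (\<lambda>\<omega>. ((U \<omega>, V \<omega>), W \<omega>))) (A \<times> space T2)"
      using measurable_space[of W M T2]
      by (subst (1 2) emeasure_distr) (auto intro!: arg_cong[where f="emeasure M"])
    then show "emeasure (distr M (S \<Otimes>\<^sub>M T1) (\<lambda>\<omega>. (U \<omega>, V \<omega>))) A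
        = emeasure (distr M S U \<Otimes>\<^sub>M distr M T1 V) A"
      using rectangle[OF A sets.top] W.emeasure_space_1 by simp
  qed (simp cong: sets_pair_measure_cong)
  show ?thesis
  proof (rule pair_measure_eqI[symmetric])
    show "sigma_finite_measure (distr M (S \<Otimes>\<^sub>M T1) (\<lambda>\<omega>. (U \<omega>, V \<omega>)))"
        "sigma_finite_measure (distr M T2 W)"
      by (auto intro!: prob_space_imp_sigma_finite prob_space_distr)
  qed (auto simp: rectangle UV cong: sets_pair_measure_cong)
qed

section \<open>Batch sizes and the contraction in one step\<close>

definition sgd_step :: "real \<Rightarrow> ('a::real_vector \<Rightarrow> 't \<Rightarrow> 'a) \<Rightarrow> nat \<Rightarrow> 'a \<Rightarrow> (nat \<Rightarrow> 't) \<Rightarrow> 'a" where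
  "sgd_step \<eta> Df m x t = x - \<eta> *\<^sub>R ((1 / real m) *\<^sub>R (\<Sum>i<m. Df x (t i)))"

locale stochastic_gradient = pi: prob_space \<pi>
  for \<pi> :: "'t measure" +
  fixes Df :: "'a::euclidean_space \<Rightarrow> 't \<Rightarrow> 'a" and F :: "'a \<Rightarrow> real" and DF :: "'a \<Rightarrow> 'a"
    and xs :: 'a and L \<mu> \<sigma> \<epsilon> tol Vs :: real and Mmin :: nat
  assumes Df_measurable [measurable]: "(\<lambda>(x, t). Df x t) \<in> borel_measurable (borel \<Otimes>\<^sub>M \<pi>)"
    and Df_integrable: "\<And>x. integrable \<pi> (Df x)"
    and Df_square_integrable: "\<And>x. integrable \<pi> (\<lambda>t. (norm (Df x t))\<^sup>2)"
    and DF_gradient: "\<And>x. GDERIV F x :> DF x"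
    and DF_mean: "\<And>x. DF x = (\<integral>t. Df x t \<partial>\<pi>)"
    and minimizer: "\<And>x. F xs \<le> F x"
    and L_pos: "L > 0" and lipschitz: "L-lipschitz_on UNIV DF"
    and mu_pos: "\<mu> > 0" and PL: "\<And>x. 1 / 2 * (norm (DF x))\<^sup>2 \<ge> \<mu> * (F x - F xs)"
    and sigma: "\<And>x y. (\<integral>t. (norm (Df x t - Df y t))\<^sup>2 \<partial>\<pi>) \<le> \<sigma>\<^sup>2 * (norm (DF x - DF y))\<^sup>2"
    and eps: "0 < \<epsilon>" "\<epsilon> < 1"
    and tol_pos: "tol > 0"
    and Vs: "Vs = (\<integral>t. (norm (Df xs t))\<^sup>2 \<partial>\<pi>)"
    and Mmin: "Mmin \<ge> 1"
begin

abbreviation "variance \<equiv> grad_variance \<pi> Df DF"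
abbreviation "admissible \<equiv> admissible_batch \<pi> Df DF \<epsilon> Mmin"
abbreviation "not_converged x \<equiv> tol < (norm (DF x))\<^sup>2"

definition "batch x = (LEAST m. admissible x m)"

definition "rate = (1 - \<epsilon>\<^sup>2) * \<mu> / L"

definition "batch_bound = 2 * \<sigma>\<^sup>2 / \<epsilon>\<^sup>2 + 2 * Vs / (\<epsilon>\<^sup>2 * tol) + real Mmin"

lemma eps_square: "0 < \<epsilon>\<^sup>2" "\<epsilon>\<^sup>2 < 1"
  using eps by (simp_all add: power_less_one_iff)

lemma rate_pos: "0 < rate"
  using eps_square mu_pos L_pos by (simp add: rate_def)

lemma DF_measurable [measurable]: "DF \<in> borel_measurable borel"
  using lipschitz by (intro borel_measurable_continuous_onI lipschitz_on_continuous_on)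

lemma F_measurable [measurable]: "F \<in> borel_measurable borel"
proof (intro borel_measurable_continuous_onI continuous_at_imp_continuous_on ballI)
  show "isCont F x" for x
    using DF_gradient[of x] by (auto simp: gderiv_def intro: has_derivative_continuous)
qed

lemma Df_measurable' [measurable]: "Df x \<in> borel_measurable \<pi>"
  by measurable

lemma variance_measurable [measurable]: "variance \<in> borel_measurable borel"
  unfolding grad_variance_def by measurable

lemma gradient_le_gap: "(norm (DF x))\<^sup>2 \<le> 2 * L * (F x - F xs)"
  by (rule gradient_norm_le_optimality_gap[OF DF_gradient L_pos lipschitz minimizer])

lemma DF_minimizer [simp]: "DF xs = 0"
  using gradient_le_gap[of xs] by simp

text \<open>
  The variance is at most the second moment of \<open>Df x\<close>, and \<open>Df x\<close> is compared with \<open>Df xs\<close>, where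
  the gradient of \<open>F\<close> vanishes, by \<open>\<parallel>u + v\<parallel>\<^sup>2 \<le> 2 \<parallel>u\<parallel>\<^sup>2 + 2 \<parallel>v\<parallel>\<^sup>2\<close>.
\<close>

lemma variance_le: "variance x \<le> 2 * \<sigma>\<^sup>2 * (norm (DF x))\<^sup>2 + 2 * Vs"
proof -
  have diff: "integrable \<pi> (\<lambda>t. (norm (Df x t - Df xs t))\<^sup>2)"
    using integrable_norm_square_add[of "Df x" \<pi> "\<lambda>t. - Df xs t"] Df_square_integrable by simp
  have "variance x \<le> (\<integral>t. (norm (Df x t))\<^sup>2 \<partial>\<pi>)"
    using pi.expectation_norm_square_centered[OF Df_integrable[of x] Df_square_integrable[of x]]
    by (simp add: grad_variance_def DF_mean)
  also have "\<dots> \<le> (\<integral>t. 2 * (norm (Df x t - Df xs t))\<^sup>2 + 2 * (norm (Df xs t))\<^sup>2 \<partial>\<pi>)"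
  proof (rule integral_mono)
    fix t
    define u where "u = Df x t - Df xs t"
    have "norm (Df x t) \<le> norm u + norm (Df xs t)"
      using norm_triangle_ineq[of u "Df xs t"] by (simp add: u_def)
    then have "(norm (Df x t))\<^sup>2 \<le> (norm u + norm (Df xs t))\<^sup>2"
      by (simp add: power_mono)
    also have "\<dots> \<le> 2 * (norm u)\<^sup>2 + 2 * (norm (Df xs t))\<^sup>2"
      using sum_squares_bound[of "norm u" "norm (Df xs t)"] by (simp add: power2_sum)
    finally show "(norm (Df x t))\<^sup>2 \<le> 2 * (norm (Df x t - Df xs t))\<^sup>2 + 2 * (norm (Df xs t))\<^sup>2"
      by (simp add: u_def)
  qed (use diff Df_square_integrable in simp_all)
  also have "\<dots> = 2 * (\<integral>t. (norm (Df x t - Df xs t))\<^sup>2 \<partial>\<pi>) + 2 * Vs"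
    using diff Df_square_integrable by (simp add: Vs)
  also have "\<dots> \<le> 2 * \<sigma>\<^sup>2 * (norm (DF x))\<^sup>2 + 2 * Vs"
    using sigma[of x xs] by simp
  finally show ?thesis .
qed

lemma Vs_nonneg: "0 \<le> Vs"
  by (simp add: Vs)

lemma batch_bound_nonneg: "0 \<le> batch_bound"
  using Vs_nonneg tol_pos by (simp add: batch_bound_def)

lemma variance_nonneg: "0 \<le> variance x"
  by (simp add: grad_variance_def)

lemma ex_admissible:
  assumes "DF x \<noteq> 0"
  shows "\<exists>m. admissible x m"
proof -
  obtain n where n: "variance x / (\<epsilon>\<^sup>2 * (norm (DF x))\<^sup>2) \<le> real n"
    using real_arch_simple by blast
  define m where "m = max Mmin n"
  have m: "0 < real m" "real n \<le> real m"
    using Mmin by (auto simp: m_def)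
  have "variance x \<le> real n * (\<epsilon>\<^sup>2 * (norm (DF x))\<^sup>2)"
    using n assms eps by (simp add: field_simps)
  also have "\<dots> \<le> real m * (\<epsilon>\<^sup>2 * (norm (DF x))\<^sup>2)"
    using m by (intro mult_right_mono) auto
  finally have "variance x / real m \<le> \<epsilon>\<^sup>2 * (norm (DF x))\<^sup>2"
    using m by (simp add: field_simps)
  then show ?thesis
    unfolding admissible_batch_def by (intro exI[of _ m]) (simp add: m_def)
qed

lemma not_converged_imp: "not_converged x \<Longrightarrow> DF x \<noteq> 0"
  using tol_pos by auto

lemma batch_admissible: "DF x \<noteq> 0 \<Longrightarrow> admissible x (batch x)"
  unfolding batch_def by (rule LeastI_ex) (rule ex_admissible)

lemma is_batch_size_eq: "is_batch_size \<pi> Df DF \<epsilon> Mmin x m \<Longrightarrow> m = batch x"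
  unfolding is_batch_size_def batch_def by (metis Least_equality)

lemma batch_measurable [measurable]: "batch \<in> borel \<rightarrow>\<^sub>M count_space UNIV"
  unfolding batch_def admissible_batch_def by measurable

text \<open>
  If the batch size exceeds \<open>Mmin\<close>, its predecessor fails the variance test and is therefore below
  \<open>V / (\<epsilon>\<^sup>2 \<parallel>DF x\<parallel>\<^sup>2)\<close>; the extra one is absorbed by \<open>Mmin \<ge> 1\<close>.
\<close>

lemma batch_le:
  assumes x: "not_converged x"
  shows "real (batch x) \<le> batch_bound"
proof -
  define g where "g = (norm (DF x))\<^sup>2"
  have g: "0 < g" "tol < g"
    using x tol_pos by (auto simp: g_def)
  have "real (batch x) \<le> real Mmin + variance x / (\<epsilon>\<^sup>2 * g)"
  proof (cases "batch x \<le> Mmin")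
    case True
    then show ?thesis
      using variance_nonneg[of x] g by (smt (verit) of_nat_mono divide_nonneg_nonneg mult_nonneg_nonneg zero_le_power2)
  next
    case False
    define n where "n = batch x - 1"
    have n: "batch x = Suc n" "Mmin \<le> n" "0 < real n"
      using False Mmin by (auto simp: n_def)
    have "\<not> admissible x n"
      using n(1) unfolding batch_def by (intro not_less_Least) simp
    then have "real n \<le> variance x / (\<epsilon>\<^sup>2 * g)"
      using n g eps by (simp add: admissible_batch_def g_def field_simps)
    then show ?thesis
      using n Mmin by simp
  qed
  also have "variance x / (\<epsilon>\<^sup>2 * g) \<le> (2 * \<sigma>\<^sup>2 * g + 2 * Vs) / (\<epsilon>\<^sup>2 * g)"
    using variance_le[of x] g by (intro divide_right_mono) (simp_all add: g_def)
  also have "\<dots> = 2 * \<sigma>\<^sup>2 / \<epsilon>\<^sup>2 + 2 * Vs / (\<epsilon>\<^sup>2 * g)"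
    using g by (simp add: add_divide_distrib)
  also have "\<dots> \<le> 2 * \<sigma>\<^sup>2 / \<epsilon>\<^sup>2 + 2 * Vs / (\<epsilon>\<^sup>2 * tol)"
    using g tol_pos eps Vs_nonneg by (intro add_left_mono divide_left_mono mult_left_mono) auto
  finally show ?thesis
    by (simp add: batch_bound_def)
qed

text \<open>
  The Polyak--Lojasiewicz inequality and smoothness bound \<open>\<parallel>DF x\<parallel>\<^sup>2\<close> between \<open>2 \<mu>\<close> and \<open>2 L\<close> times
  the gap, so \<open>\<mu> \<le> L\<close> as soon as some gap is positive. If \<open>F\<close> is constant, \<open>\<mu>\<close> can be arbitrarily
  large.
\<close>

lemma rate_le_one:
  assumes "DF x \<noteq> 0"
  shows "rate \<le> 1"
proof -
  have gap: "2 * \<mu> * (F x - F xs) \<le> 2 * L * (F x - F xs)"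
    using PL[of x] gradient_le_gap[of x] by simp
  have "0 < 2 * L * (F x - F xs)"
    using gradient_le_gap[of x] assms by (smt (verit) zero_less_norm_iff zero_less_power)
  then have "\<mu> \<le> L"
    using gap L_pos by (simp add: zero_less_mult_iff)
  moreover have "(1 - \<epsilon>\<^sup>2) * \<mu> \<le> 1 * \<mu>"
    using mu_pos by (intro mult_right_mono) auto
  ultimately show ?thesis
    using L_pos by (simp add: rate_def)
qed

text \<open>
  With \<open>u\<close> the batch mean, the smoothness bound at step size \<open>1 / L\<close> equals
  \<open>F x - \<parallel>DF x\<parallel>\<^sup>2 / (2 L) + \<parallel>u - DF x\<parallel>\<^sup>2 / (2 L)\<close>, so only the mean square error of \<open>u\<close> enters. It is
  the variance divided by the batch size, which the batch rule keeps below \<open>\<epsilon>\<^sup>2 \<parallel>DF x\<parallel>\<^sup>2\<close>.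
\<close>

lemma expected_gap_after_step:
  fixes T :: "nat \<Rightarrow> 'w \<Rightarrow> 't"
  assumes P: "prob_space P"
    and T [measurable]: "\<And>i. T i \<in> P \<rightarrow>\<^sub>M \<pi>" and law: "\<And>i. distr P \<pi> (T i) = \<pi>"
    and indep: "prob_space.indep_vars P (\<lambda>_. \<pi>) T UNIV"
    and x: "not_converged x"
  shows "(\<integral>\<^sup>+\<omega>. ennreal (F (sgd_step (1 / L) Df (batch x) x (\<lambda>i. T i \<omega>)) - F xs) \<partial>P)
    \<le> ennreal ((1 - rate) * (F x - F xs))"
proof -
  interpret P: prob_space P by (rule P)
  define m where "m = batch x"
  have adm: "admissible x m"
    unfolding m_def by (intro batch_admissible not_converged_imp x)
  then have m: "0 < real m" and var: "variance x / real m \<le> \<epsilon>\<^sup>2 * (norm (DF x))\<^sup>2"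
    using Mmin by (auto simp: admissible_batch_def)
  define Z where "Z = (\<lambda>i \<omega>. Df x (T i \<omega>) - DF x)"
  have Z_law: "integrable P (\<lambda>\<omega>. h (T i \<omega>)) \<and> (\<integral>\<omega>. h (T i \<omega>) \<partial>P) = (\<integral>t. h t \<partial>\<pi>)"
    if "integrable \<pi> h" for i and h :: "'t \<Rightarrow> 'b::{banach, second_countable_topology}"
    using that integrable_distr_eq[OF T, of h i] integral_distr[OF T, of h i] by (simp add: law)
  have sq: "integrable \<pi> (\<lambda>t. (norm (Df x t - DF x))\<^sup>2)"
    using integrable_norm_square_add[of "Df x" \<pi> "\<lambda>t. - DF x"] Df_square_integrable by simp
  have Z: "integrable P (Z i)" "integrable P (\<lambda>\<omega>. (norm (Z i \<omega>))\<^sup>2)"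
      "P.expectation (Z i) = 0" "P.expectation (\<lambda>\<omega>. (norm (Z i \<omega>))\<^sup>2) = variance x" for i
    using Z_law[OF sq, of i] Z_law[of "\<lambda>t. Df x t - DF x" i] Df_integrable[of x]
    by (auto simp: Z_def grad_variance_def DF_mean pi.prob_space)
  have "P.indep_vars (\<lambda>_. borel) Z {..<m}"
    unfolding Z_def by (rule P.indep_vars_compose2[OF P.indep_vars_subset[OF indep]]) auto
  note S = P.expectation_norm_square_sum_indep_centered[OF finite_lessThan this Z(1-3)]
  define err where "err = (\<lambda>\<omega>. (norm ((1 / real m) *\<^sub>R (\<Sum>i<m. Z i \<omega>)))\<^sup>2)"
  have err_eq: "err = (\<lambda>\<omega>. (1 / real m)\<^sup>2 * (norm (\<Sum>i<m. Z i \<omega>))\<^sup>2)"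
    by (simp add: err_def power_divide power_mult_distrib)
  have "P.expectation err = (1 / real m)\<^sup>2 * (real m * variance x)"
    by (simp add: err_eq S(2) Z(4))
  also have "\<dots> = variance x / real m"
    using m by (simp add: power2_eq_square)
  finally have err: "integrable P err" "P.expectation err \<le> \<epsilon>\<^sup>2 * (norm (DF x))\<^sup>2"
    using S(1) var by (simp_all add: err_eq)
  have "(\<integral>\<^sup>+\<omega>. ennreal (F (sgd_step (1 / L) Df (batch x) x (\<lambda>i. T i \<omega>)) - F xs) \<partial>P)
      \<le> (\<integral>\<^sup>+\<omega>. ennreal ((F x - F xs) - (norm (DF x))\<^sup>2 / (2 * L) + err \<omega> / (2 * L)) \<partial>P)"
  proof (intro nn_integral_mono ennreal_leI)
    fix \<omega>
    define u where "u = (1 / real m) *\<^sub>R (\<Sum>i<m. Df x (T i \<omega>))"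
    have err_u: "err \<omega> = (norm (u - DF x))\<^sup>2"
      using m by (simp add: err_def u_def Z_def sum_subtractf scaleR_diff_right sum_constant_scaleR)
    have "F (x - (1 / L) *\<^sub>R u) \<le> F x - (1 / L) * (DF x \<bullet> u) + L / 2 * ((1 / L) * norm u)\<^sup>2"
      using lipschitz_gradient_quadratic_upper_bound[OF DF_gradient lipschitz, of "x - (1 / L) *\<^sub>R u" x]
        L_pos by simp
    also have "\<dots> = F x - (norm (DF x))\<^sup>2 / (2 * L) + err \<omega> / (2 * L)"
    proof -
      have "err \<omega> = (norm u)\<^sup>2 - 2 * (DF x \<bullet> u) + (norm (DF x))\<^sup>2"
        by (simp add: err_u power2_norm_eq_inner inner_simps inner_commute)
      moreover have "L / 2 * ((1 / L) * norm u)\<^sup>2 = (norm u)\<^sup>2 / (2 * L)"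
        using L_pos by (simp add: power2_eq_square field_simps)
      ultimately show ?thesis
        using L_pos by (simp add: diff_divide_distrib add_divide_distrib)
    qed
    finally show "F (sgd_step (1 / L) Df (batch x) x (\<lambda>i. T i \<omega>)) - F xs
        \<le> (F x - F xs) - (norm (DF x))\<^sup>2 / (2 * L) + err \<omega> / (2 * L)"
      by (simp add: sgd_step_def u_def m_def)
  qed
  also have "\<dots> = ennreal (P.expectation (\<lambda>\<omega>. (F x - F xs) - (norm (DF x))\<^sup>2 / (2 * L) + err \<omega> / (2 * L)))"
  proof (rule nn_integral_eq_integral)
    have "0 \<le> (F x - F xs) - (norm (DF x))\<^sup>2 / (2 * L)"
      using gradient_le_gap[of x] L_pos by (simp add: field_simps)
    then show "AE \<omega> in P. 0 \<le> (F x - F xs) - (norm (DF x))\<^sup>2 / (2 * L) + err \<omega> / (2 * L)"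
      using L_pos by (simp add: err_def)
  qed (use err in simp)
  also have "\<dots> \<le> ennreal ((1 - rate) * (F x - F xs))"
  proof (rule ennreal_leI)
    have "P.expectation (\<lambda>\<omega>. (F x - F xs) - (norm (DF x))\<^sup>2 / (2 * L) + err \<omega> / (2 * L))
        = (F x - F xs) - (norm (DF x))\<^sup>2 / (2 * L) + P.expectation err / (2 * L)"
      using err by (simp add: P.prob_space)
    also have "\<dots> \<le> (F x - F xs) - (norm (DF x))\<^sup>2 / (2 * L) + \<epsilon>\<^sup>2 * (norm (DF x))\<^sup>2 / (2 * L)"
      using err L_pos by (intro add_left_mono divide_right_mono) auto
    also have "\<dots> = (F x - F xs) - (1 - \<epsilon>\<^sup>2) / L * (1 / 2 * (norm (DF x))\<^sup>2)"
      using L_pos by (simp add: field_simps)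
    also have "\<dots> \<le> (F x - F xs) - (1 - \<epsilon>\<^sup>2) / L * (\<mu> * (F x - F xs))"
      using PL[of x] eps_square L_pos by (intro diff_left_mono mult_left_mono) auto
    also have "\<dots> = (1 - rate) * (F x - F xs)"
      by (simp add: rate_def algebra_simps)
    finally show "P.expectation (\<lambda>\<omega>. (F x - F xs) - (norm (DF x))\<^sup>2 / (2 * L) + err \<omega> / (2 * L))
        \<le> (1 - rate) * (F x - F xs)" .
  qed
  finally show ?thesis .
qed

end

section \<open>The run frozen at its first converged iterate\<close>

context stochastic_gradient
begin

text \<open>
  A deterministic function of the starting point and the array of all samples. Freezing makes
  convergence absorbing, so the current iterate alone tells whether any earlier one has converged.
\<close>

primrec frozen_iterate :: "nat \<Rightarrow> 'a \<Rightarrow> (nat \<times> nat \<Rightarrow> 't) \<Rightarrow> 'a" where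
  "frozen_iterate 0 x w = x"
| "frozen_iterate (Suc k) x w =
    (if not_converged (frozen_iterate k x w)
     then sgd_step (1 / L) Df (batch (frozen_iterate k x w)) (frozen_iterate k x w) (\<lambda>i. w (k, i))
     else frozen_iterate k x w)"

text \<open>
  The number of summands is random but takes countably many values.
\<close>

lemma batch_step_measurable:
  assumes X [measurable]: "X \<in> N \<rightarrow>\<^sub>M borel" and W [measurable]: "\<And>i. (\<lambda>z. W z i) \<in> N \<rightarrow>\<^sub>M \<pi>"
  shows "(\<lambda>z. sgd_step (1 / L) Df (batch (X z)) (X z) (W z)) \<in> borel_measurable N"
proof (rule measurable_compose_countable[where f = "\<lambda>m z. sgd_step (1 / L) Df m (X z) (W z)"])
  show "(\<lambda>z. sgd_step (1 / L) Df m (X z) (W z)) \<in> borel_measurable N" for m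
  proof -
    have [measurable]: "(\<lambda>z. Df (X z) (W z i)) \<in> borel_measurable N" for i
      using measurable_compose[OF measurable_Pair[OF X W] Df_measurable] by simp
    show ?thesis
      unfolding sgd_step_def by measurable
  qed
qed measurable

text \<open>
  Allowing any index set \<open>J\<close> that contains the past samples lets the induction pass from \<open>k\<close> to
  \<open>Suc k\<close> without changing the product space.
\<close>

lemma frozen_iterate_measurable:
  assumes "{..<k} \<times> UNIV \<subseteq> J"
  shows "(\<lambda>(x, w). frozen_iterate k x w) \<in> borel \<Otimes>\<^sub>M PiM J (\<lambda>_. \<pi>) \<rightarrow>\<^sub>M borel"
  using assms
proof (induction k)
  case (Suc k)
  let ?N = "borel \<Otimes>\<^sub>M PiM J (\<lambda>_. \<pi>)"
  have "{..<k} \<times> UNIV \<subseteq> J"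
    using Suc.prems by auto
  then have [measurable]: "(\<lambda>z. frozen_iterate k (fst z) (snd z)) \<in> ?N \<rightarrow>\<^sub>M borel"
    using Suc.IH by (simp add: case_prod_beta')
  have [measurable]: "(\<lambda>z. snd z (k, i)) \<in> ?N \<rightarrow>\<^sub>M \<pi>" for i
    by (rule measurable_compose[OF measurable_snd measurable_component_singleton])
       (use Suc.prems in auto)
  have [measurable]: "(\<lambda>z. sgd_step (1 / L) Df (batch (frozen_iterate k (fst z) (snd z)))
      (frozen_iterate k (fst z) (snd z)) (\<lambda>i. snd z (k, i))) \<in> ?N \<rightarrow>\<^sub>M borel"
    by (rule batch_step_measurable) measurable
  show ?case
    unfolding frozen_iterate.simps case_prod_beta' by measurable
qed (simp add: case_prod_beta')

lemma frozen_iterate_restrict: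
  "{..<k} \<times> UNIV \<subseteq> J \<Longrightarrow> frozen_iterate k x (restrict w J) = frozen_iterate k x w"
proof (induction k)
  case (Suc k)
  then have "{..<k} \<times> UNIV \<subseteq> J" "(k, i) \<in> J" for i
    by auto
  with Suc.IH show ?case
    by simp
qed simp

end

locale adaptive_sgd_run = stochastic_gradient \<pi> Df F DF xs L \<mu> \<sigma> \<epsilon> tol Vs Mmin + P: prob_space P
  for P :: "'w measure" and \<pi> :: "'t measure"
    and Df :: "'a::euclidean_space \<Rightarrow> 't \<Rightarrow> 'a" and F DF xs L \<mu> \<sigma> \<epsilon> tol Vs Mmin +
  fixes \<theta> :: "nat \<Rightarrow> nat \<Rightarrow> 'w \<Rightarrow> 't" and \<xi> :: "nat \<Rightarrow> 'w \<Rightarrow> 'a" and M :: "nat \<Rightarrow> 'w \<Rightarrow> nat"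
  assumes run: "sgd_adaptive P \<pi> Df DF (1 / L) \<epsilon> Mmin \<theta> \<xi> M"
    and F0_integrable: "integrable P (\<lambda>\<omega>. F (\<xi> 0 \<omega>))"
begin

definition "samples \<omega> = (\<lambda>(k, i). \<theta> k i \<omega>)"

definition "X k \<omega> = frozen_iterate k (\<xi> 0 \<omega>) (samples \<omega>)"

lemma xi_measurable [measurable]: "\<xi> k \<in> borel_measurable P"
  and M_measurable [measurable]: "M k \<in> P \<rightarrow>\<^sub>M count_space UNIV"
  and fresh: "fresh_samples P \<pi> (\<xi> 0) \<theta>"
  using run by (auto simp: sgd_adaptive_def)

lemma theta_measurable [measurable]: "\<theta> k i \<in> P \<rightarrow>\<^sub>M \<pi>"
  and theta_law: "distr P \<pi> (\<theta> k i) = \<pi>"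
  and theta_indep: "P.indep_vars (\<lambda>_. \<pi>) (\<lambda>p \<omega>. samples \<omega> p) UNIV"
  and theta_indep_start: "P.indep_set (sets (vimage_algebra (space P) (\<xi> 0) borel))
       (sets (vimage_algebra (space P) samples (PiM UNIV (\<lambda>_. \<pi>))))"
proof -
  show "\<theta> k i \<in> P \<rightarrow>\<^sub>M \<pi>" "distr P \<pi> (\<theta> k i) = \<pi>"
    using fresh by (auto simp: fresh_samples_def)
  have "(\<lambda>p \<omega>. samples \<omega> p) = (\<lambda>(k, i). \<theta> k i)" "samples = (\<lambda>\<omega> (k, i). \<theta> k i \<omega>)"
    by (auto simp: samples_def fun_eq_iff)
  then show "P.indep_vars (\<lambda>_. \<pi>) (\<lambda>p \<omega>. samples \<omega> p) UNIV"
    "P.indep_set (sets (vimage_algebra (space P) (\<xi> 0) borel))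
       (sets (vimage_algebra (space P) samples (PiM UNIV (\<lambda>_. \<pi>))))"
    using fresh by (auto simp: fresh_samples_def)
qed

lemma samples_measurable [measurable]: "samples \<in> P \<rightarrow>\<^sub>M PiM UNIV (\<lambda>_. \<pi>)"
  by (rule measurable_PiM_single') (auto simp: samples_def case_prod_beta intro: measurable_space[OF theta_measurable])

lemma X_measurable [measurable]: "X k \<in> borel_measurable P"
proof -
  have "(\<lambda>\<omega>. (\<lambda>(x, w). frozen_iterate k x w) (\<xi> 0 \<omega>, samples \<omega>)) \<in> borel_measurable P"
    by (rule measurable_compose[OF _ frozen_iterate_measurable]) measurable
  then show ?thesis
    by (simp add: X_def[abs_def])
qed

text \<open>
  The samples drawn in iteration \<open>k\<close>, kept as a function on their index pairs so that blocks of
  samples live in products over disjoint index sets.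
\<close>

abbreviation "block k \<omega> \<equiv> restrict (samples \<omega>) ({k} \<times> UNIV)"

lemma restrict_samples_measurable [measurable]:
  "(\<lambda>\<omega>. restrict (samples \<omega>) J) \<in> P \<rightarrow>\<^sub>M PiM J (\<lambda>_. \<pi>)"
  by (rule measurable_compose[OF samples_measurable measurable_restrict_subset]) simp

text \<open>
  The iterate is a function of the starting point and the blocks below \<open>k\<close>, which are disjoint from
  block \<open>k\<close>; regrouping the starting point with the past samples gives the product law.
\<close>

lemma current_iterate_indep_block:
  "distr P (borel \<Otimes>\<^sub>M PiM ({k} \<times> UNIV) (\<lambda>_. \<pi>)) (\<lambda>\<omega>. (X k \<omega>, block k \<omega>))
    = distr P borel (X k) \<Otimes>\<^sub>M distr P (PiM ({k} \<times> UNIV) (\<lambda>_. \<pi>)) (block k)"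
proof -
  let ?A = "{..<k} \<times> (UNIV :: nat set)" and ?B = "{k} \<times> (UNIV :: nat set)"
  let ?past = "\<lambda>\<omega>. restrict (samples \<omega>) ?A"
  let ?NA = "PiM ?A (\<lambda>_. \<pi>)" and ?NB = "PiM ?B (\<lambda>_. \<pi>)"
  have "P.indep_var ?NA ?past ?NB (block k)"
    using P.indep_var_restrict[OF theta_indep, of ?A ?B] by auto
  then have past_block: "distr P (?NA \<Otimes>\<^sub>M ?NB) (\<lambda>\<omega>. (?past \<omega>, block k \<omega>))
      = distr P ?NA ?past \<Otimes>\<^sub>M distr P ?NB (block k)"
    by (simp add: P.indep_var_distribution_eq)
  have [measurable]: "(\<lambda>w. (restrict w ?A, restrict w ?B)) \<in> PiM UNIV (\<lambda>_. \<pi>) \<rightarrow>\<^sub>M ?NA \<Otimes>\<^sub>M ?NB"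
    by (intro measurable_Pair measurable_restrict_subset) auto
  have "distr P (borel \<Otimes>\<^sub>M (?NA \<Otimes>\<^sub>M ?NB)) (\<lambda>\<omega>. (\<xi> 0 \<omega>, ?past \<omega>, block k \<omega>))
      = distr P borel (\<xi> 0) \<Otimes>\<^sub>M distr P (?NA \<Otimes>\<^sub>M ?NB) (\<lambda>\<omega>. (?past \<omega>, block k \<omega>))"
    by (rule P.joint_law_compose[where f="\<lambda>x. x" and g="\<lambda>w. (restrict w ?A, restrict w ?B)",
          OF _ _ _ _ P.joint_law_eq_pair_measure[OF _ _ theta_indep_start]]) measurable
  from P.joint_law_assoc[OF _ _ _ this past_block]
  have joint: "distr P ((borel \<Otimes>\<^sub>M ?NA) \<Otimes>\<^sub>M ?NB) (\<lambda>\<omega>. ((\<xi> 0 \<omega>, ?past \<omega>), block k \<omega>))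
      = distr P (borel \<Otimes>\<^sub>M ?NA) (\<lambda>\<omega>. (\<xi> 0 \<omega>, ?past \<omega>)) \<Otimes>\<^sub>M distr P ?NB (block k)"
    by simp
  have "distr P (borel \<Otimes>\<^sub>M ?NB)
        (\<lambda>\<omega>. ((\<lambda>(x, w). frozen_iterate k x w) (\<xi> 0 \<omega>, ?past \<omega>), block k \<omega>))
      = distr P borel (\<lambda>\<omega>. (\<lambda>(x, w). frozen_iterate k x w) (\<xi> 0 \<omega>, ?past \<omega>))
        \<Otimes>\<^sub>M distr P ?NB (block k)"
    by (rule P.joint_law_compose[where g="\<lambda>w. w", OF _ _ frozen_iterate_measurable _ joint])
       (auto simp: space_PiM)
  then show ?thesis
    by (simp add: frozen_iterate_restrict X_def[abs_def])
qed

text \<open>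
  The expected gap on the event that iteration \<open>k\<close> has not converged. An extended nonnegative
  integral allows Fubini without a prior proof that the gap at \<open>k\<close> is integrable; finiteness follows
  from the contraction.
\<close>

definition "mean_active_gap k =
  (\<integral>\<^sup>+\<omega>. ennreal (F (X k \<omega>) - F xs) * indicator {x. not_converged x} (X k \<omega>) \<partial>P)"

lemma not_converged_measurable [measurable]: "{x. not_converged x} \<in> sets borel"
  by measurable

lemma mean_active_gap_0:
  "mean_active_gap 0 \<le> ennreal (\<integral>\<omega>. F (\<xi> 0 \<omega>) - F xs \<partial>P)"
proof -
  have "mean_active_gap 0 \<le> (\<integral>\<^sup>+\<omega>. ennreal (F (\<xi> 0 \<omega>) - F xs) \<partial>P)"
    unfolding mean_active_gap_def X_def
    by (intro nn_integral_mono) (simp split: split_indicator)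
  also have "\<dots> = ennreal (\<integral>\<omega>. F (\<xi> 0 \<omega>) - F xs \<partial>P)"
    using F0_integrable minimizer by (intro nn_integral_eq_integral) simp_all
  finally show ?thesis .
qed

text \<open>
  The current samples are independent of the current iterate, so the expectation can be taken over
  the samples with the iterate held fixed at \<open>x\<close>, where the contraction for a single step applies.
\<close>

lemma mean_active_gap_Suc:
  "mean_active_gap (Suc k) \<le> ennreal (1 - rate) * mean_active_gap k"
proof -
  let ?NB = "PiM ({k} \<times> UNIV) (\<lambda>_. \<pi>)"
  define h where "h = (\<lambda>(x, w). ennreal (F (sgd_step (1 / L) Df (batch x) x (\<lambda>i. w (k, i))) - F xs)
    * indicator {x. not_converged x} x)"
  have "(\<lambda>z. sgd_step (1 / L) Df (batch (fst z)) (fst z) (\<lambda>i. snd z (k, i)))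
      \<in> borel_measurable (borel \<Otimes>\<^sub>M ?NB)"
    by (rule batch_step_measurable)
       (auto intro!: measurable_compose[OF measurable_snd measurable_component_singleton])
  then have h [measurable]: "h \<in> borel_measurable (borel \<Otimes>\<^sub>M ?NB)"
    unfolding h_def case_prod_beta' by measurable
  interpret W: prob_space "distr P ?NB (block k)"
    by (rule P.prob_space_distr) measurable
  \<comment> \<open>Converged iterates stay put, so an active successor has an active predecessor.\<close>
  have "mean_active_gap (Suc k) \<le> (\<integral>\<^sup>+\<omega>. h (X k \<omega>, block k \<omega>) \<partial>P)"
    unfolding mean_active_gap_def
    by (intro nn_integral_mono) (auto simp: h_def X_def split: split_indicator)
  also have "\<dots> = (\<integral>\<^sup>+z. h z \<partial>distr P (borel \<Otimes>\<^sub>M ?NB) (\<lambda>\<omega>. (X k \<omega>, block k \<omega>)))"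
    by (rule nn_integral_distr[symmetric]) measurable
  also have "\<dots> = (\<integral>\<^sup>+x. \<integral>\<^sup>+w. h (x, w) \<partial>distr P ?NB (block k) \<partial>distr P borel (X k))"
    unfolding current_iterate_indep_block
    by (rule W.nn_integral_fst[symmetric]) (simp cong: measurable_cong_sets sets_pair_measure_cong)
  also have "\<dots> \<le> (\<integral>\<^sup>+x. ennreal (1 - rate) * (ennreal (F x - F xs) * indicator {x. not_converged x} x)
      \<partial>distr P borel (X k))"
  proof (rule nn_integral_mono)
    fix x
    show "(\<integral>\<^sup>+w. h (x, w) \<partial>distr P ?NB (block k))
        \<le> ennreal (1 - rate) * (ennreal (F x - F xs) * indicator {x. not_converged x} x)"
    proof (cases "not_converged x")
      case True
      have "P.indep_vars (\<lambda>i. PiM {(k, i)} (\<lambda>_. \<pi>)) (\<lambda>i \<omega>. restrict (samples \<omega>) {(k, i)}) UNIV"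
        using P.indep_vars_restrict[OF theta_indep, of UNIV "\<lambda>i. {(k, i)}"]
        by (simp add: disjoint_family_on_def)
      then have "P.indep_vars (\<lambda>_. \<pi>)
          (\<lambda>i \<omega>. (\<lambda>w. w (k, i)) (restrict (samples \<omega>) {(k, i)})) UNIV"
        by (rule P.indep_vars_compose2) simp
      then have "P.indep_vars (\<lambda>_. \<pi>) (\<theta> k) UNIV"
        by (simp add: samples_def)
      have "(\<integral>\<^sup>+w. h (x, w) \<partial>distr P ?NB (block k)) = (\<integral>\<^sup>+\<omega>. h (x, block k \<omega>) \<partial>P)"
        by (rule nn_integral_distr) measurable
      also have "\<dots> = (\<integral>\<^sup>+\<omega>. ennreal (F (sgd_step (1 / L) Df (batch x) x (\<lambda>i. \<theta> k i \<omega>)) - F xs) \<partial>P)"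
        using True by (simp add: h_def samples_def)
      also have "\<dots> \<le> ennreal ((1 - rate) * (F x - F xs))"
        by (rule expected_gap_after_step[OF P.prob_space_axioms theta_measurable theta_law]) fact+
      also have "\<dots> = ennreal (1 - rate) * ennreal (F x - F xs)"
        using minimizer[of x] rate_le_one[OF not_converged_imp[OF True]] by (intro ennreal_mult) auto
      finally show ?thesis
        using True by simp
    qed (simp add: h_def)
  qed
  also have "\<dots> = ennreal (1 - rate) * mean_active_gap k"
    unfolding mean_active_gap_def
    by (subst nn_integral_distr) (simp_all add: nn_integral_cmult)
  finally show ?thesis .
qed

lemma mean_active_gap_le:
  "mean_active_gap k \<le> ennreal (\<integral>\<omega>. F (\<xi> 0 \<omega>) - F xs \<partial>P)"
proof (induction k)
  case (Suc k)
  have "mean_active_gap (Suc k) \<le> ennreal (1 - rate) * mean_active_gap k"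
    by (rule mean_active_gap_Suc)
  also have "\<dots> \<le> 1 * mean_active_gap k"
    using rate_pos by (intro mult_right_mono) (auto simp flip: ennreal_1 intro: ennreal_leI)
  finally show ?case
    using Suc by simp
qed (rule mean_active_gap_0)

definition "active k = {\<omega> \<in> space P. not_converged (X k \<omega>)}"

lemma active_events [measurable]: "active k \<in> sets P"
  unfolding active_def by measurable

text \<open>
  Markov's inequality: where the run is active, \<open>tol < \<parallel>DF\<parallel>\<^sup>2 \<le> 2 L (F - F xs)\<close>.
\<close>

lemma prob_active_le:
  "ennreal tol * emeasure P (active k) \<le> ennreal (2 * L) * mean_active_gap k"
proof -
  have "ennreal tol * emeasure P (active k) = (\<integral>\<^sup>+\<omega>. ennreal tol * indicator (active k) \<omega> \<partial>P)"
    by (simp add: nn_integral_cmult_indicator)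
  also have "\<dots> \<le> (\<integral>\<^sup>+\<omega>. ennreal (2 * L)
      * (ennreal (F (X k \<omega>) - F xs) * indicator {x. not_converged x} (X k \<omega>)) \<partial>P)"
  proof (rule nn_integral_mono)
    fix \<omega> assume "\<omega> \<in> space P"
    show "ennreal tol * indicator (active k) \<omega> \<le> ennreal (2 * L)
        * (ennreal (F (X k \<omega>) - F xs) * indicator {x. not_converged x} (X k \<omega>))"
      using gradient_le_gap[of "X k \<omega>"] L_pos minimizer[of "X k \<omega>"]
      by (auto simp: active_def simp flip: ennreal_mult intro!: ennreal_leI split: split_indicator)
  qed
  also have "\<dots> = ennreal (2 * L) * mean_active_gap k"
    unfolding mean_active_gap_def by (rule nn_integral_cmult) measurable
  finally show ?thesis .
qed

lemma sum_prob_active_le: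
  "(\<Sum>k<n. P.prob (active k))
    \<le> (1 + max 0 (ln (inverse tol * 2 * L * (\<integral>\<omega>. F (\<xi> 0 \<omega>) - F xs \<partial>P)))) / rate"
proof -
  let ?gap = "\<integral>\<omega>. F (\<xi> 0 \<omega>) - F xs \<partial>P"
  define c where "c = (\<lambda>k. inverse tol * 2 * L * enn2real (mean_active_gap k))"
  have finite: "mean_active_gap k < \<top>" for k
    using mean_active_gap_le[of k] by (rule order.strict_trans1) simp
  have gap: "enn2real (mean_active_gap 0) \<le> ?gap"
    using mean_active_gap_0 minimizer by (intro enn2real_leI) simp_all
  have prob: "P.prob (active k) \<le> min 1 (c k)" for k
  proof -
    have "ennreal (tol * P.prob (active k)) \<le> ennreal (2 * L * enn2real (mean_active_gap k))"
      using prob_active_le[of k] tol_pos L_pos finite[of k]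
      by (simp add: ennreal_mult P.emeasure_eq_measure)
    then have "tol * P.prob (active k) \<le> 2 * L * enn2real (mean_active_gap k)"
      using L_pos by (simp add: ennreal_le_iff)
    then show ?thesis
      using tol_pos by (simp add: c_def field_simps)
  qed
  have contraction: "enn2real (mean_active_gap (Suc k)) \<le> (1 - rate) * enn2real (mean_active_gap k)" for k
  proof (cases "\<exists>x. DF x \<noteq> 0")
    case True
    then have "rate \<le> 1"
      using rate_le_one by blast
    then show ?thesis
      using mean_active_gap_Suc[of k] finite[of k]
      by (intro enn2real_leI) (auto simp: ennreal_mult)
  next
    case False
    \<comment> \<open>Here \<open>F\<close> is constant and \<open>1 - rate\<close> may be negative, but no iterate is ever active.\<close>
    then have "mean_active_gap k = 0" for k
      using tol_pos by (simp add: mean_active_gap_def)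
    then show ?thesis
      by simp
  qed
  have "(\<Sum>k<n. P.prob (active k)) \<le> (\<Sum>k<n. min 1 (c k))"
    by (intro sum_mono prob)
  also have "\<dots> \<le> (1 + max 0 (ln (inverse tol * 2 * L * ?gap))) / rate"
  proof (rule sum_min_one_contracting_le)
    show "0 \<le> c k" for k
      using tol_pos L_pos by (simp add: c_def)
    show "c (Suc k) \<le> (1 - rate) * c k" for k
      using mult_left_mono[OF contraction[of k], of "inverse tol * 2 * L"] tol_pos L_pos
      by (simp add: c_def ac_simps)
    show "c 0 \<le> inverse tol * 2 * L * ?gap"
      using gap tol_pos L_pos by (simp add: c_def)
  qed (rule rate_pos)
  finally show ?thesis .
qed

end

section \<open>Stopping time and sampling cost\<close>

context adaptive_sgd_run
begin

abbreviation "T \<equiv> stopping_iteration DF tol \<xi>"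

lemma before_stopping_not_converged: "k < T \<omega> \<Longrightarrow> not_converged (\<xi> k \<omega>)"
  using not_less_Least[of k "\<lambda>k. (norm (DF (\<xi> k \<omega>)))\<^sup>2 \<le> tol"]
  by (simp add: stopping_iteration_def)

lemma AE_step:
  "AE \<omega> in P. \<forall>k. not_converged (\<xi> k \<omega>) \<longrightarrow> M k \<omega> = batch (\<xi> k \<omega>) \<and>
     \<xi> (Suc k) \<omega> = sgd_step (1 / L) Df (batch (\<xi> k \<omega>)) (\<xi> k \<omega>) (\<lambda>i. \<theta> k i \<omega>)"
proof -
  have "AE \<omega> in P. \<forall>k. (\<exists>m. admissible (\<xi> k \<omega>) m) \<longrightarrow>
        is_batch_size \<pi> Df DF \<epsilon> Mmin (\<xi> k \<omega>) (M k \<omega>) \<and>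
        \<xi> (Suc k) \<omega> =
          \<xi> k \<omega> - (1 / L) *\<^sub>R ((1 / real (M k \<omega>)) *\<^sub>R (\<Sum>i<M k \<omega>. Df (\<xi> k \<omega>) (\<theta> k i \<omega>)))"
    using run by (simp add: sgd_adaptive_def)
  then show ?thesis
  proof (rule AE_mp, intro AE_I2 impI allI)
    fix \<omega> k
    assume *: "\<forall>k. (\<exists>m. admissible (\<xi> k \<omega>) m) \<longrightarrow>
        is_batch_size \<pi> Df DF \<epsilon> Mmin (\<xi> k \<omega>) (M k \<omega>) \<and>
        \<xi> (Suc k) \<omega> =
          \<xi> k \<omega> - (1 / L) *\<^sub>R ((1 / real (M k \<omega>)) *\<^sub>R (\<Sum>i<M k \<omega>. Df (\<xi> k \<omega>) (\<theta> k i \<omega>)))"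
      and k: "not_converged (\<xi> k \<omega>)"
    have size: "is_batch_size \<pi> Df DF \<epsilon> Mmin (\<xi> k \<omega>) (M k \<omega>)"
      and step: "\<xi> (Suc k) \<omega> =
          \<xi> k \<omega> - (1 / L) *\<^sub>R ((1 / real (M k \<omega>)) *\<^sub>R (\<Sum>i<M k \<omega>. Df (\<xi> k \<omega>) (\<theta> k i \<omega>)))"
      using * ex_admissible[OF not_converged_imp[OF k]] by blast+
    show "M k \<omega> = batch (\<xi> k \<omega>) \<and>
     \<xi> (Suc k) \<omega> = sgd_step (1 / L) Df (batch (\<xi> k \<omega>)) (\<xi> k \<omega>) (\<lambda>i. \<theta> k i \<omega>)"
      using step by (simp add: sgd_step_def flip: is_batch_size_eq[OF size])
  qed
qed

text \<open>
  Up to the first converged iterate the run and its frozen version follow the same recursion, so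
  they coincide almost surely as long as no earlier iterate has converged.
\<close>

lemma AE_active:
  "AE \<omega> in P. \<forall>k. (\<forall>j\<le>k. not_converged (\<xi> j \<omega>)) \<longrightarrow> \<omega> \<in> active k \<and> real (M k \<omega>) \<le> batch_bound"
  using AE_step
proof (rule AE_mp, intro AE_I2 impI allI)
  fix \<omega> k
  assume \<omega>: "\<omega> \<in> space P"
    and step: "\<forall>k. not_converged (\<xi> k \<omega>) \<longrightarrow> M k \<omega> = batch (\<xi> k \<omega>) \<and>
     \<xi> (Suc k) \<omega> = sgd_step (1 / L) Df (batch (\<xi> k \<omega>)) (\<xi> k \<omega>) (\<lambda>i. \<theta> k i \<omega>)"
    and k: "\<forall>j\<le>k. not_converged (\<xi> j \<omega>)"
  have "(\<forall>j<n. not_converged (\<xi> j \<omega>)) \<Longrightarrow> X n \<omega> = \<xi> n \<omega>" for n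
  proof (induction n)
    case (Suc n)
    then show ?case
      using step by (auto simp: X_def samples_def)
  qed (simp add: X_def)
  then have "X k \<omega> = \<xi> k \<omega>"
    using k by simp
  then show "\<omega> \<in> active k \<and> real (M k \<omega>) \<le> batch_bound"
    using k \<omega> step batch_le[of "\<xi> k \<omega>"] by (auto simp: active_def)
qed

definition "iteration_bound =
  (1 + max 0 (ln (inverse tol * 2 * L * (\<integral>\<omega>. F (\<xi> 0 \<omega>) - F xs \<partial>P)))) / rate"

lemma iteration_bound_nonneg: "0 \<le> iteration_bound"
  using rate_pos by (simp add: iteration_bound_def)

lemma expected_active_count:
  "(\<integral>\<^sup>+\<omega>. (\<Sum>k. indicator (active k) \<omega>) \<partial>P) \<le> ennreal iteration_bound"
proof -
  have "(\<integral>\<^sup>+\<omega>. (\<Sum>k. indicator (active k) \<omega>) \<partial>P) = (\<Sum>k. emeasure P (active k))"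
    by (subst nn_integral_suminf) simp_all
  also have "\<dots> \<le> ennreal iteration_bound"
  proof (rule suminf_le_const)
    show "(\<Sum>k<n. emeasure P (active k)) \<le> ennreal iteration_bound" for n
      using sum_prob_active_le[of n]
      by (simp add: P.emeasure_eq_measure sum_ennreal iteration_bound_def ennreal_leI)
  qed simp
  finally show ?thesis .
qed

text \<open>
  A run that never stops is active at every iteration, but the number of active iterations has
  finite expectation.
\<close>

lemma AE_stops: "AE \<omega> in P. \<exists>k. (norm (DF (\<xi> k \<omega>)))\<^sup>2 \<le> tol"
proof -
  have "(\<integral>\<^sup>+\<omega>. (\<Sum>k. indicator (active k) \<omega>) \<partial>P) \<noteq> \<infinity>"
    using order.strict_trans1[OF expected_active_count ennreal_less_top] by simp
  then have "AE \<omega> in P. (\<Sum>k. indicator (active k) \<omega> :: ennreal) \<noteq> \<infinity>"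
    by (intro nn_integral_PInf_AE) measurable
  with AE_active show ?thesis
  proof eventually_elim
    case (elim \<omega>)
    show ?case
    proof (rule ccontr)
      assume "\<nexists>k. (norm (DF (\<xi> k \<omega>)))\<^sup>2 \<le> tol"
      then have "\<omega> \<in> active k" for k
        using elim(1) by (simp add: not_le)
      then have "of_nat n \<le> (\<Sum>k. indicator (active k) \<omega> :: ennreal)" for n
        using sum_le_suminf[of "\<lambda>k. indicator (active k) \<omega> :: ennreal" "{..<n}"] by simp
      moreover obtain n where "(\<Sum>k. indicator (active k) \<omega> :: ennreal) < of_nat n"
        using ennreal_Ex_less_of_nat[of "\<Sum>k. indicator (active k) \<omega>"] elim(2)
        by (auto simp: less_top)
      ultimately show False
        by (meson not_le)
    qed
  qed
qed

lemma AE_sampling_cost_le: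
  "AE \<omega> in P. ennreal (sampling_cost DF tol \<xi> M \<omega>)
    \<le> ennreal batch_bound * (\<Sum>k. indicator (active k) \<omega>)"
  using AE_active
proof eventually_elim
  case (elim \<omega>)
  have "ennreal (sampling_cost DF tol \<xi> M \<omega>) = (\<Sum>k<T \<omega>. ennreal (real (M k \<omega>)))"
    by (simp add: sampling_cost_def sum_ennreal)
  also have "\<dots> \<le> (\<Sum>k<T \<omega>. ennreal batch_bound * indicator (active k) \<omega>)"
  proof (rule sum_mono)
    fix k assume "k \<in> {..<T \<omega>}"
    then have "\<forall>j\<le>k. not_converged (\<xi> j \<omega>)"
      using before_stopping_not_converged by simp
    then show "ennreal (real (M k \<omega>)) \<le> ennreal batch_bound * indicator (active k) \<omega>"
      using elim by (simp add: ennreal_leI)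
  qed
  also have "\<dots> \<le> (\<Sum>k. ennreal batch_bound * indicator (active k) \<omega>)"
    by (rule sum_le_suminf) simp_all
  also have "\<dots> = ennreal batch_bound * (\<Sum>k. indicator (active k) \<omega>)"
    by simp
  finally show ?case .
qed

lemma sampling_cost_measurable [measurable]: "sampling_cost DF tol \<xi> M \<in> borel_measurable P"
proof -
  have [measurable]: "T \<in> P \<rightarrow>\<^sub>M count_space UNIV"
    unfolding stopping_iteration_def by measurable
  show ?thesis
    unfolding sampling_cost_def[abs_def]
    by (rule measurable_compose_countable[where g = T and f = "\<lambda>n \<omega>. \<Sum>k<n. real (M k \<omega>)"])
      measurable
qed

lemma sampling_cost_integrable: "integrable P (sampling_cost DF tol \<xi> M)"
  and expected_sampling_cost_le:
    "(\<integral>\<omega>. sampling_cost DF tol \<xi> M \<omega> \<partial>P) \<le> batch_bound * iteration_bound"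
proof -
  have nonneg: "0 \<le> sampling_cost DF tol \<xi> M \<omega>" for \<omega>
    by (simp add: sampling_cost_def sum_nonneg)
  have "(\<integral>\<^sup>+\<omega>. ennreal (sampling_cost DF tol \<xi> M \<omega>) \<partial>P)
      \<le> (\<integral>\<^sup>+\<omega>. ennreal batch_bound * (\<Sum>k. indicator (active k) \<omega>) \<partial>P)"
    by (rule nn_integral_mono_AE[OF AE_sampling_cost_le])
  also have "\<dots> = ennreal batch_bound * (\<integral>\<^sup>+\<omega>. (\<Sum>k. indicator (active k) \<omega>) \<partial>P)"
    by (rule nn_integral_cmult) measurable
  also have "\<dots> \<le> ennreal batch_bound * ennreal iteration_bound"
    by (rule mult_left_mono[OF expected_active_count]) simp
  also have "\<dots> = ennreal (batch_bound * iteration_bound)"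
    by (rule ennreal_mult[symmetric]) (rule batch_bound_nonneg iteration_bound_nonneg)+
  finally have bound: "(\<integral>\<^sup>+\<omega>. ennreal (sampling_cost DF tol \<xi> M \<omega>) \<partial>P)
      \<le> ennreal (batch_bound * iteration_bound)" .
  show int: "integrable P (sampling_cost DF tol \<xi> M)"
    using order.strict_trans1[OF bound ennreal_less_top] nonneg
    by (intro integrableI_nonneg) auto
  show "(\<integral>\<omega>. sampling_cost DF tol \<xi> M \<omega> \<partial>P) \<le> batch_bound * iteration_bound"
    using bound nonneg batch_bound_nonneg iteration_bound_nonneg
    by (simp add: nn_integral_eq_integral[OF int] ennreal_le_iff)
qed

end

text \<open>
  At \<open>C = 0\<close> both conventions for the logarithm, \<open>ln 0 = 0\<close> and \<open>-\<infinity>\<close>, give maximum \<open>0\<close>.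
\<close>

lemma ereal_max_ln_ext:
  assumes "0 < q" "0 \<le> C"
  shows "max 0 (ereal q * ln_ext C) + ereal q = ereal (q * (1 + max 0 (ln C)))"
proof (cases "C = 0")
  case True
  then show ?thesis
    using assms by (simp add: ln_ext_def max_def)
next
  case False
  have "max 0 (q * ln C) = q * max 0 (ln C)"
    using assms by (simp add: max_def mult_le_0_iff zero_le_mult_iff)
  then have "max 0 (ereal (q * ln C)) = ereal (q * max 0 (ln C))"
    by (metis ereal_max zero_ereal_def)
  then show ?thesis
    using False by (simp add: ln_ext_def algebra_simps)
qed

theorem corollary6:
  fixes P :: "'w measure" and \<pi> :: "'t measure"
    and f :: "real ^ 'd \<Rightarrow> 't \<Rightarrow> real"
    and Df :: "real ^ 'd \<Rightarrow> 't \<Rightarrow> real ^ 'd"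
    and F :: "real ^ 'd \<Rightarrow> real"
    and DF :: "real ^ 'd \<Rightarrow> real ^ 'd"
    and xs :: "real ^ 'd"
    and \<theta> :: "nat \<Rightarrow> nat \<Rightarrow> 'w \<Rightarrow> 't"
    and \<xi> :: "nat \<Rightarrow> 'w \<Rightarrow> real ^ 'd"
    and M :: "nat \<Rightarrow> 'w \<Rightarrow> nat"
    and Mmin :: nat
    and L \<mu> \<kappa> \<sigma> \<epsilon> tol Vs :: real
  assumes "prob_space P" and "prob_space \<pi>"
    and f_integrable: "\<And>x. integrable \<pi> (f x)"
    and F_mean: "\<And>x. F x = (\<integral>t. f x t \<partial>\<pi>)"
    and Df_gradient: "\<And>x. AE t in \<pi>. GDERIV (\<lambda>y. f y t) x :> Df x t"
    and Df_measurable: "(\<lambda>(x, t). Df x t) \<in> borel_measurable (borel \<Otimes>\<^sub>M \<pi>)"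
    and Df_integrable: "\<And>x. integrable \<pi> (Df x)"
    and Df_square_integrable: "\<And>x. integrable \<pi> (\<lambda>t. (norm (Df x t))\<^sup>2)"
    and DF_gradient: "\<And>x. GDERIV F x :> DF x"
    and DF_mean: "\<And>x. DF x = (\<integral>t. Df x t \<partial>\<pi>)"
    and minimizer: "\<And>x. F xs \<le> F x"
    and convex: "convex_on UNIV F"
    and L: "L > 0" "L-lipschitz_on UNIV DF"
    and PL: "\<mu> > 0" "\<And>x. 1 / 2 * (norm (DF x))\<^sup>2 \<ge> \<mu> * (F x - F xs)"
    and kappa: "\<kappa> = L / \<mu>"
    and sigma: "\<And>x y. (\<integral>t. (norm (Df x t - Df y t))\<^sup>2 \<partial>\<pi>) \<le> \<sigma>\<^sup>2 * (norm (DF x - DF y))\<^sup>2"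
    and eps: "0 < \<epsilon>" "\<epsilon> < 1"
    and tol: "tol > 0"
    and Vs: "Vs = (\<integral>t. (norm (Df xs t))\<^sup>2 \<partial>\<pi>)"
    and Mmin: "Mmin \<ge> 1"
    and run: "sgd_adaptive P \<pi> Df DF (1 / L) \<epsilon> Mmin \<theta> \<xi> M"
    and F0_integrable: "integrable P (\<lambda>\<omega>. F (\<xi> 0 \<omega>))"
  shows "(AE \<omega> in P. (\<exists>k. (norm (DF (\<xi> k \<omega>)))\<^sup>2 \<le> tol) \<and>
            (\<forall>k < stopping_iteration DF tol \<xi> \<omega>.
               \<exists>m. admissible_batch \<pi> Df DF \<epsilon> Mmin (\<xi> k \<omega>) m) \<and>
            (norm (DF (\<xi> (stopping_iteration DF tol \<xi> \<omega>) \<omega>)))\<^sup>2 \<le> tol) \<and>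
         integrable P (sampling_cost DF tol \<xi> M) \<and>
         ereal (\<integral>\<omega>. sampling_cost DF tol \<xi> M \<omega> \<partial>P) \<le>
           ereal (3 * (\<sigma>\<^sup>2 + 1) / \<epsilon>\<^sup>2 + 2 * Vs / (\<epsilon>\<^sup>2 * tol) + real Mmin) *
           (max 0 (ereal (\<kappa> / (1 - \<epsilon>\<^sup>2)) *
                   ln_ext (inverse tol * 2 * L * (\<integral>\<omega>. F (\<xi> 0 \<omega>) - F xs \<partial>P)))
            + ereal (\<kappa> / (1 - \<epsilon>\<^sup>2)))"
proof -
  interpret P: prob_space P by fact
  interpret pi: prob_space \<pi> by fact
  interpret adaptive_sgd_run P \<pi> Df F DF xs L \<mu> \<sigma> \<epsilon> tol Vs Mmin \<theta> \<xi> M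
    by unfold_locales (fact assms | rule assms)+
  let ?gap = "\<integral>\<omega>. F (\<xi> 0 \<omega>) - F xs \<partial>P"
  let ?B = "3 * (\<sigma>\<^sup>2 + 1) / \<epsilon>\<^sup>2 + 2 * Vs / (\<epsilon>\<^sup>2 * tol) + real Mmin"
  have q: "\<kappa> / (1 - \<epsilon>\<^sup>2) = 1 / rate"
    by (simp add: rate_def kappa)
  have "0 \<le> inverse tol * 2 * L * ?gap"
    using tol_pos L_pos minimizer by (intro mult_nonneg_nonneg integral_nonneg_AE) auto
  then have rhs: "max 0 (ereal (\<kappa> / (1 - \<epsilon>\<^sup>2)) * ln_ext (inverse tol * 2 * L * ?gap))
      + ereal (\<kappa> / (1 - \<epsilon>\<^sup>2)) = ereal iteration_bound"
    using rate_pos by (simp add: q ereal_max_ln_ext iteration_bound_def)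
  have "2 * \<sigma>\<^sup>2 / \<epsilon>\<^sup>2 \<le> 3 * (\<sigma>\<^sup>2 + 1) / \<epsilon>\<^sup>2"
    by (intro divide_right_mono) auto
  then have "batch_bound * iteration_bound \<le> ?B * iteration_bound"
    by (intro mult_right_mono iteration_bound_nonneg) (simp add: batch_bound_def)
  with expected_sampling_cost_le
  have cost: "ereal (\<integral>\<omega>. sampling_cost DF tol \<xi> M \<omega> \<partial>P) \<le> ereal ?B * ereal iteration_bound"
    by simp
  have "AE \<omega> in P. (\<exists>k. (norm (DF (\<xi> k \<omega>)))\<^sup>2 \<le> tol) \<and>
            (\<forall>k < stopping_iteration DF tol \<xi> \<omega>.
               \<exists>m. admissible_batch \<pi> Df DF \<epsilon> Mmin (\<xi> k \<omega>) m) \<and>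
            (norm (DF (\<xi> (stopping_iteration DF tol \<xi> \<omega>) \<omega>)))\<^sup>2 \<le> tol"
    using AE_stops
  proof eventually_elim
    case (elim \<omega>)
    then have "(norm (DF (\<xi> (T \<omega>) \<omega>)))\<^sup>2 \<le> tol"
      unfolding stopping_iteration_def by (rule LeastI_ex)
    then show ?case
      using elim before_stopping_not_converged ex_admissible not_converged_imp by blast
  qed
  with sampling_cost_integrable cost show ?thesis
    unfolding rhs by blast
qed

end
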